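(* There is an algorithm, running in time polynomial in $m$ and $n$, which solves the following problem. The input is a pair of integer vectors $H=(h,\ldots,h)$ of length $m$ and $V=(v_1,\ldots,v_n)$ of length $n$, where either $V=(v,\ldots,v)$ is homogeneous or $V=(v,\ldots,v,v-1,\ldots,v-1)$ takes exactly the two consecutive values $v$ and $v-1$, and where (1) $h\le n$ and $v\le m$; (2) $mh=\sum_{j=1}^n v_j$; (3) $v\le \frac{h}{n}\binom{n}{h}$. The output is an $m\times n$ binary matrix with pairwise distinct rows, in which every row sum equals $h$ and the $j$-th column sum equals $v_j$ for every $1\le j\le n$ (that is, the incidence matrix of an $h$-uniform hypergraph without parallel hyperedges with $m$ hyperedges and degree sequence $V$).
   Context: A binary matrix has entries in $\{0,1\}$. Rows of the incidence matrix of a hypergraph correspond to hyperedges and columns to vertices; an $h$-uniform hypergraph has all hyperedges of cardinality $h$. Here $m,n,h,v$ are positive integers. *)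

theory Defs
  imports "Jordan_Normal_Form.Matrix" "HOL-Computational_Algebra.Polynomial"
begin

text \<open>
  The model of computation is the random access machine with structured control: registers
  and memory cells hold natural numbers, memory is addressed indirectly, and every evaluated
  node of an expression and every executed command costs one time unit. The only arithmetic
  is addition and truncated subtraction. In particular there is no multiplication, so the
  length of a number grows by at most a constant, depending only on the program, per time
  unit, and polynomial time here coincides with polynomial time on Turing machines.
\<close>

datatype expr =
    Const nat
  | Reg nat
  | Mem expr
  | Add expr expr
  | Sub expr expr

datatype com =
    Skip
  | Assign nat expr
  | Store expr expr
  | Seq com com
  | If expr com com
  | While expr com

text \<open>A state consists of the contents of the registers and the contents of the memory.\<close>

type_synonym state = "(nat \<Rightarrow> nat) \<times> (nat \<Rightarrow> nat)"

fun val :: "expr \<Rightarrow> state \<Rightarrow> nat" where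
  "val (Const k) s = k"
| "val (Reg r) s = fst s r"
| "val (Mem a) s = snd s (val a s)"
| "val (Add a b) s = val a s + val b s"
| "val (Sub a b) s = val a s - val b s"

fun cost :: "expr \<Rightarrow> nat" where
  "cost (Const k) = 1"
| "cost (Reg r) = 1"
| "cost (Mem a) = 1 + cost a"
| "cost (Add a b) = 1 + cost a + cost b"
| "cost (Sub a b) = 1 + cost a + cost b"

text \<open>
  \<open>exec c s t s'\<close>: started in \<open>s\<close>, the program \<open>c\<close> halts in \<open>s'\<close> after exactly \<open>t\<close> time units.
  In tests, a nonzero value means true.
\<close>

inductive exec :: "com \<Rightarrow> state \<Rightarrow> nat \<Rightarrow> state \<Rightarrow> bool" where
  Skip: "exec Skip s 1 s"
| Assign: "exec (Assign r a) s (1 + cost a) ((fst s)(r := val a s), snd s)"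
| Store: "exec (Store a b) s (1 + cost a + cost b) (fst s, (snd s)(val a s := val b s))"
| Seq: "exec c1 s t1 s1 \<Longrightarrow> exec c2 s1 t2 s2 \<Longrightarrow> exec (Seq c1 c2) s (1 + t1 + t2) s2"
| IfTrue: "val b s \<noteq> 0 \<Longrightarrow> exec c1 s t s' \<Longrightarrow> exec (If b c1 c2) s (1 + cost b + t) s'"
| IfFalse: "val b s = 0 \<Longrightarrow> exec c2 s t s' \<Longrightarrow> exec (If b c1 c2) s (1 + cost b + t) s'"
| WhileFalse: "val b s = 0 \<Longrightarrow> exec (While b c) s (1 + cost b) s"
| WhileTrue: "val b s \<noteq> 0 \<Longrightarrow> exec c s t1 s1 \<Longrightarrow> exec (While b c) s1 t2 s2 \<Longrightarrow>
    exec (While b c) s (1 + cost b + t1 + t2) s2"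

inductive_cases SkipE: "exec Skip s t s'"
inductive_cases AssignE: "exec (Assign r a) s t s'"
inductive_cases StoreE: "exec (Store a b) s t s'"
inductive_cases SeqE: "exec (Seq c1 c2) s t s'"
inductive_cases IfE: "exec (If b c1 c2) s t s'"
inductive_cases WhileE: "exec (While b c) s t s'"

lemma exec_deterministic:
  "exec c s t s' \<Longrightarrow> exec c s u s'' \<Longrightarrow> u = t \<and> s'' = s'"
proof (induction arbitrary: u s'' rule: exec.induct)
  case (Skip s)
  then show ?case by (elim SkipE) simp
next
  case (Assign r a s)
  then show ?case by (elim AssignE) simp
next
  case (Store a b s)
  then show ?case by (elim StoreE) simp
next
  case (Seq c1 s t1 s1 c2 t2 s2)
  from Seq.prems show ?case
  proof (rule SeqE)
    fix t1' s1' t2'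
    assume u: "u = Suc (t1' + t2')" and 1: "exec c1 s t1' s1'" and 2: "exec c2 s1' t2' s''"
    from Seq.IH(1)[OF 1] have t1: "t1' = t1" and s1: "s1' = s1" by simp_all
    from Seq.IH(2)[OF 2[unfolded s1]] show ?thesis by (simp add: u t1)
  qed
next
  case (IfTrue b s c1 t s' c2)
  from IfTrue.prems show ?case
    using IfTrue.hyps by (elim IfE) (auto dest: IfTrue.IH)
next
  case (IfFalse b s c2 t s' c1)
  from IfFalse.prems show ?case
    using IfFalse.hyps by (elim IfE) (auto dest: IfFalse.IH)
next
  case (WhileFalse b s c)
  from WhileFalse.prems show ?case
    by (rule WhileE) (use WhileFalse.hyps in simp_all)
next
  case (WhileTrue b s c t1 s1 t2 s2)
  from WhileTrue.prems show ?case
  proof (rule WhileE)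
    assume "val b s = 0"
    then show ?thesis using WhileTrue.hyps by simp
  next
    fix t1' s1' t2'
    assume u: "u = Suc (cost b + t1' + t2')"
      and 1: "exec c s t1' s1'" and 2: "exec (While b c) s1' t2' s''"
    from WhileTrue.IH(1)[OF 1] have t1: "t1' = t1" and s1: "s1' = s1" by simp_all
    from WhileTrue.IH(2)[OF 2[unfolded s1]] show ?thesis by (simp add: u t1)
  qed
qed

text \<open>
  Input and output conventions: initially the memory holds the two lengths followed by the
  entries of the two vectors, and is zero elsewhere, as are all registers. At the end, the
  output matrix is read row by row from the beginning of the memory.
\<close>

definition input_state :: "nat list \<Rightarrow> nat list \<Rightarrow> state" where
  "input_state H V =
    (let xs = length H # length V # H @ V
     in (\<lambda>r. 0, \<lambda>a. if a < length xs then xs ! a else 0))"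

definition output_mat :: "nat \<Rightarrow> nat \<Rightarrow> state \<Rightarrow> nat mat" where
  "output_mat m n s = mat m n (\<lambda>(i, j). snd s (i * n + j))"

definition binary_mat :: "nat mat \<Rightarrow> bool" where
  "binary_mat M \<longleftrightarrow> elements_mat M \<subseteq> {0, 1}"

definition distinct_rows :: "'a mat \<Rightarrow> bool" where
  "distinct_rows M \<longleftrightarrow> distinct (rows M)"

definition row_sum :: "'a::comm_monoid_add mat \<Rightarrow> nat \<Rightarrow> 'a" where
  "row_sum M i = (\<Sum>j<dim_col M. M $$ (i, j))"

definition col_sum :: "'a::comm_monoid_add mat \<Rightarrow> nat \<Rightarrow> 'a" where
  "col_sum M j = (\<Sum>i<dim_row M. M $$ (i, j))"

text \<open>A polynomial in two variables, as a polynomial whose coefficients are polynomials.\<close>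

definition poly2 :: "nat poly poly \<Rightarrow> nat \<Rightarrow> nat \<Rightarrow> nat" where
  "poly2 P x y = poly (poly P [:x:]) y"

end

theory Submission
  imports Defs
begin

text \<open>
  An edge is \<^emph>\<open>swapped\<close> by replacing a vertex \<open>a\<close> in it by a vertex \<open>b\<close> outside it. A nonempty
  family of \<open>h\<close>-sets closed under swaps contains all \<open>h\<close>-sets, so a breadth-first search through
  swaps, started at one edge, produces \<open>m\<close> distinct edges because (2) and (3) give
  \<open>m \<le> n choose h\<close>. The degrees are then corrected: as long as \<open>a\<close> has too large and \<open>b\<close> too small
  a degree, \<open>a\<close> has larger degree than \<open>b\<close>, because the prescribed degrees differ by at most one.
  Hence more edges contain only \<open>a\<close> than only \<open>b\<close>, and some swap of \<open>a\<close> by \<open>b\<close> leads outside the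
  family. A single pass over all \<open>(a, b, i)\<close> suffices, since a swap neither makes an earlier
  failed swap of \<open>a\<close> by \<open>b\<close> possible nor unbalances a vertex that was already settled.

  The edges are kept in place as the rows of the output matrix. A candidate swap is written
  to the first unused row and compared with all rows in use.
\<close>

section \<open>Weakest preconditions with bounded loops\<close>

notation Seq (infixr ";;" 60)

text \<open>
  Total correctness where, in addition, every execution of a loop makes at most \<open>N\<close> iterations.
  The running time is then at most \<open>bnd N c\<close>, whatever the states, so that time and correctness
  can be treated separately.
\<close>

primrec wp :: "nat \<Rightarrow> com \<Rightarrow> (state \<Rightarrow> bool) \<Rightarrow> state \<Rightarrow> bool" where
  "wp N Skip Q = Q"
| "wp N (Assign r a) Q = (\<lambda>s. Q ((fst s)(r := val a s), snd s))"
| "wp N (Store a b) Q = (\<lambda>s. Q (fst s, (snd s)(val a s := val b s)))"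
| "wp N (c1 ;; c2) Q = wp N c1 (wp N c2 Q)"
| "wp N (If b c1 c2) Q = (\<lambda>s. if val b s \<noteq> 0 then wp N c1 Q s else wp N c2 Q s)"
| "wp N (While b c) Q =
    ((\<lambda>X s. if val b s = 0 then Q s else wp N c X s) ^^ Suc N) (\<lambda>_. False)"

text \<open>Adding both branches of \<open>If\<close>, rather than taking their maximum, keeps the
  bound polynomial in \<open>N\<close>. The factor \<open>Suc N\<close> covers \<open>N\<close> runs
  of a loop body and the final failing test.\<close>

primrec bnd :: "nat \<Rightarrow> com \<Rightarrow> nat" where
  "bnd N Skip = 1"
| "bnd N (Assign r a) = 1 + cost a"
| "bnd N (Store a b) = 1 + cost a + cost b"
| "bnd N (c1 ;; c2) = 1 + bnd N c1 + bnd N c2"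
| "bnd N (If b c1 c2) = 1 + cost b + bnd N c1 + bnd N c2"
| "bnd N (While b c) = Suc N * (1 + cost b + bnd N c)"

primrec mods :: "com \<Rightarrow> nat set" where
  "mods Skip = {}"
| "mods (Assign r a) = {r}"
| "mods (Store a b) = {}"
| "mods (c1 ;; c2) = mods c1 \<union> mods c2"
| "mods (If b c1 c2) = mods c1 \<union> mods c2"
| "mods (While b c) = mods c"

text \<open>Each application of the loop functional pays for one test and at most one run of the
  body, so an inner induction on the number of applications yields termination and the time bound
  together.\<close>

lemma wp_exec: "wp N c Q s \<Longrightarrow> \<exists>t s'. exec c s t s' \<and> t \<le> bnd N c \<and> Q s'"
proof (induction c arbitrary: Q s)
  case Skip
  then show ?case using exec.Skip[of s] by (intro exI[of _ 1] exI[of _ s]) simp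
next
  case (Assign r a)
  then show ?case by (auto intro!: exI exec.Assign)
next
  case (Store a b)
  then show ?case by (auto intro!: exI exec.Store)
next
  case (Seq c1 c2)
  from Seq.prems have "wp N c1 (wp N c2 Q) s" by simp
  from Seq.IH(1)[OF this] obtain t1 s1
    where 1: "exec c1 s t1 s1" "t1 \<le> bnd N c1" "wp N c2 Q s1" by blast
  from Seq.IH(2)[OF 1(3)] obtain t2 s2
    where 2: "exec c2 s1 t2 s2" "t2 \<le> bnd N c2" "Q s2" by blast
  from exec.Seq[OF 1(1) 2(1)] 1(2) 2(2,3) show ?case
    by (intro exI[of _ "1 + t1 + t2"] exI[of _ s2]) simp
next
  case (If b c1 c2)
  show ?case
  proof (cases "val b s = 0")
    case True
    with If.prems have "wp N c2 Q s" by simp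
    from If.IH(2)[OF this] obtain t s' where "exec c2 s t s'" "t \<le> bnd N c2" "Q s'" by blast
    with exec.IfFalse[OF True] show ?thesis
      by (intro exI[of _ "1 + cost b + t"] exI[of _ s']) simp
  next
    case False
    with If.prems have "wp N c1 Q s" by simp
    from If.IH(1)[OF this] obtain t s' where "exec c1 s t s'" "t \<le> bnd N c1" "Q s'" by blast
    with exec.IfTrue[OF False] show ?thesis
      by (intro exI[of _ "1 + cost b + t"] exI[of _ s']) simp
  qed
next
  case (While b c)
  let ?F = "\<lambda>X s. if val b s = 0 then Q s else wp N c X s"
  have "\<exists>t s'. exec (While b c) s t s' \<and> t \<le> k * (1 + cost b + bnd N c) \<and> Q s'"
    if "(?F ^^ k) (\<lambda>_. False) s" for k s
    using that
  proof (induction k arbitrary: s)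
    case 0
    then show ?case by simp
  next
    case (Suc k)
    show ?case
    proof (cases "val b s = 0")
      case True
      with Suc.prems have "Q s" by simp
      with exec.WhileFalse[OF True, of c] show ?thesis
        by (intro exI[of _ "1 + cost b"] exI[of _ s]) simp
    next
      case False
      with Suc.prems have "wp N c ((?F ^^ k) (\<lambda>_. False)) s" by simp
      from While.IH[OF this] obtain t1 s1
        where 1: "exec c s t1 s1" "t1 \<le> bnd N c" "(?F ^^ k) (\<lambda>_. False) s1" by blast
      from Suc.IH[OF 1(3)] obtain t2 s2
        where 2: "exec (While b c) s1 t2 s2" "t2 \<le> k * (1 + cost b + bnd N c)" "Q s2" by blast
      from exec.WhileTrue[OF False 1(1) 2(1)] 1(2) 2(2,3) show ?thesis
        by (intro exI[of _ "1 + cost b + t1 + t2"] exI[of _ s2]) simp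
    qed
  qed
  from this[of "Suc N" s] While.prems show ?case by simp
qed

text \<open>Consequence and frame rule in one: the new postcondition may use that registers not
  assigned by \<open>c\<close> keep their initial values, so loop invariants can leave them
  out.\<close>

lemma wp_frame:
  assumes "wp N c Q s"
    and "\<And>s'. Q s' \<Longrightarrow> (\<And>z. z \<notin> mods c \<Longrightarrow> fst s' z = fst s z) \<Longrightarrow> Q' s'"
  shows "wp N c Q' s"
  using assms
proof (induction c arbitrary: Q Q' s)
  case (Seq c1 c2)
  from Seq.prems(1) have "wp N c1 (wp N c2 Q) s" by simp
  then have "wp N c1 (wp N c2 Q') s"
  proof (rule Seq.IH(1))
    fix s1
    assume 1: "wp N c2 Q s1" "\<And>z. z \<notin> mods c1 \<Longrightarrow> fst s1 z = fst s z"
    show "wp N c2 Q' s1"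
      by (rule Seq.IH(2)[OF 1(1)]) (use 1(2) Seq.prems(2) in auto)
  qed
  then show ?case by simp
next
  case (If b c1 c2)
  show ?case
  proof (cases "val b s = 0")
    case True
    with If.prems(1) have "wp N c2 Q s" by simp
    from If.IH(2)[OF this, of Q'] True If.prems(2) show ?thesis by simp
  next
    case False
    with If.prems(1) have "wp N c1 Q s" by simp
    from If.IH(1)[OF this, of Q'] False If.prems(2) show ?thesis by simp
  qed
next
  case (While b c)
  let ?F = "\<lambda>Q X s. if val b s = 0 then Q s else wp N c X s"
  have "(?F Q' ^^ k) (\<lambda>_. False) s1"
    if "(?F Q ^^ k) (\<lambda>_. False) s1" and "\<And>z. z \<notin> mods c \<Longrightarrow> fst s1 z = fst s z" for k s1
    using that
  proof (induction k arbitrary: s1)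
    case (Suc k)
    show ?case
    proof (cases "val b s1 = 0")
      case True
      with Suc.prems While.prems(2) show ?thesis by simp
    next
      case False
      with Suc.prems(1) have "wp N c ((?F Q ^^ k) (\<lambda>_. False)) s1" by simp
      then have "wp N c ((?F Q' ^^ k) (\<lambda>_. False)) s1"
        by (rule While.IH) (use Suc.IH Suc.prems(2) in auto)
      with False show ?thesis by simp
    qed
  qed simp
  from this[of "Suc N" s] While.prems(1) show ?case by simp
qed simp_all

section \<open>Counting loops\<close>

definition For :: "nat \<Rightarrow> nat \<Rightarrow> com \<Rightarrow> com" where
  "For x y c = Assign x (Const 0) ;;
    While (Sub (Reg y) (Reg x)) (c ;; Assign x (Add (Reg x) (Const 1)))"

lemma mods_For [simp]: "mods (For x y c) = insert x (mods c)"
  by (auto simp: For_def)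

text \<open>Thanks to \<open>wp_frame\<close>, the invariant \<open>I\<close> has to track only the
  memory and the registers that the body changes. The postcondition in \<open>step\<close>
  anticipates the increment of the counter.\<close>

lemma wp_For:
  assumes K: "R0 y = K" "K \<le> N"
    and fresh: "x \<notin> mods c" "y \<notin> mods c" "x \<noteq> y"
    and init: "I 0 (R0(x := 0)) M0"
    and step: "\<And>k R M. \<lbrakk>k < K; R x = k; \<And>z. z \<notin> insert x (mods c) \<Longrightarrow> R z = R0 z; I k R M\<rbrakk> \<Longrightarrow>
      wp N c (\<lambda>s. I (Suc k) ((fst s)(x := Suc k)) (snd s)) (R, M)"
    and fin: "\<And>R M. \<lbrakk>\<And>z. z \<notin> insert x (mods c) \<Longrightarrow> R z = R0 z; I K R M\<rbrakk> \<Longrightarrow> Q (R, M)"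
  shows "wp N (For x y c) Q (R0, M0)"
proof -
  let ?b = "Sub (Reg y) (Reg x)" and ?c = "c ;; Assign x (Add (Reg x) (Const 1))"
  let ?F = "\<lambda>X s. if val ?b s = 0 then Q s else wp N ?c X s"
  \<comment> \<open>Here \<open>d\<close> applications of the loop functional remain;
    \<open>K - k < d\<close> reserves one of them for the failing test at
    \<open>k = K\<close>.\<close>
  have "(?F ^^ d) (\<lambda>_. False) (R, M)"
    if "K - k < d" "k \<le> K" "R x = k" "\<And>z. z \<notin> insert x (mods c) \<Longrightarrow> R z = R0 z" "I k R M"
    for d k R M
    using that
  proof (induction d arbitrary: k R M)
    case (Suc d)
    have y: "R y = K" using Suc.prems(4)[of y] fresh K by simp
    show ?case
    proof (cases "k = K")
      case True
      then show ?thesis using Suc.prems y fin by simp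
    next
      case False
      with Suc.prems have k: "k < K" by simp
      have "wp N c (\<lambda>s. (?F ^^ d) (\<lambda>_. False) ((fst s)(x := Suc (fst s x)), snd s)) (R, M)"
      proof (rule wp_frame[OF step[OF k Suc.prems(3,4,5)]])
        fix s'
        assume s': "I (Suc k) ((fst s')(x := Suc k)) (snd s')"
          "\<And>z. z \<notin> mods c \<Longrightarrow> fst s' z = fst (R, M) z"
        have x: "fst s' x = k" using s'(2)[of x] fresh Suc.prems(3) by simp
        show "(?F ^^ d) (\<lambda>_. False) ((fst s')(x := Suc (fst s' x)), snd s')"
          unfolding x
        proof (rule Suc.IH[OF _ _ _ _ s'(1)])
          show "K - Suc k < d" "Suc k \<le> K" using Suc.prems(1) k by simp_all
          show "((fst s')(x := Suc k)) x = Suc k" by simp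
          show "((fst s')(x := Suc k)) z = R0 z" if "z \<notin> insert x (mods c)" for z
            using that s'(2)[of z] Suc.prems(4)[of z] by simp
        qed
      qed
      with k y Suc.prems(3) show ?thesis by simp
    qed
  qed simp
  from this[of 0 "Suc N" "R0(x := 0)" M0] K(2) init
  have "(?F ^^ Suc N) (\<lambda>_. False) (R0(x := 0), M0)" by simp
  then have "wp N (While ?b ?c) Q (R0(x := 0), M0)" by (simp only: wp.simps)
  then show ?thesis by (simp add: For_def del: wp.simps(6))
qed

text \<open>The bound is built from constants and \<open>Suc N\<close> by sums and products, under
  which polynomials are closed.\<close>

lemma bnd_poly: "\<exists>P. \<forall>m n. bnd (m + n) c = poly2 P m n"
proof -
  have const: "\<exists>P. \<forall>m n. k = poly2 P m n" for k
    by (rule exI[of _ "[:[:k:]:]"]) (simp add: poly2_def)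
  have add: "\<exists>P. \<forall>m n. f m n + g m n = poly2 P m n"
    if "\<exists>P. \<forall>m n. f m n = poly2 P m n" "\<exists>P. \<forall>m n. g m n = poly2 P m n" for f g
  proof -
    from that obtain P1 P2 where "\<And>m n. f m n = poly2 P1 m n" "\<And>m n. g m n = poly2 P2 m n" by blast
    then show ?thesis by (intro exI[of _ "P1 + P2"]) (simp add: poly2_def)
  qed
  have mult: "\<exists>P. \<forall>m n. f m n * g m n = poly2 P m n"
    if "\<exists>P. \<forall>m n. f m n = poly2 P m n" "\<exists>P. \<forall>m n. g m n = poly2 P m n" for f g
  proof -
    from that obtain P1 P2 where "\<And>m n. f m n = poly2 P1 m n" "\<And>m n. g m n = poly2 P2 m n" by blast
    then show ?thesis by (intro exI[of _ "P1 * P2"]) (simp add: poly2_def)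
  qed
  \<comment> \<open>\<open>poly2\<close> substitutes \<open>m\<close> for the outer and
    \<open>n\<close> for the inner variable, so the witness is 1 + m + n.\<close>
  have N: "\<exists>P. \<forall>m n. Suc (m + n) = poly2 P m n"
    by (rule exI[of _ "[:[:1, 1:], 1:]"]) (simp add: poly2_def)
  show ?thesis
  proof (induction c)
    case (Seq c1 c2)
    show ?case unfolding bnd.simps by (intro add const Seq.IH)
  next
    case (If b c1 c2)
    show ?case unfolding bnd.simps by (intro add const If.IH)
  next
    case (While b c)
    show ?case unfolding bnd.simps by (intro mult N add const While.IH)
  qed (unfold bnd.simps, (rule const)+)
qed

section \<open>Swaps in uniform hypergraphs\<close>

definition hedge :: "nat \<Rightarrow> (nat \<Rightarrow> nat) \<Rightarrow> nat \<Rightarrow> nat set" where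
  "hedge n M i = {j. j < n \<and> M (i * n + j) = 1}"

text \<open>Entries at most 1 make a row recoverable from its set of columns, and its sum equal to
  the cardinality. Only the first \<open>r\<close> rows are constrained, which leaves row
  \<open>r\<close> free for a candidate.\<close>

definition family :: "nat \<Rightarrow> nat \<Rightarrow> nat \<Rightarrow> (nat \<Rightarrow> nat) \<Rightarrow> bool" where
  "family n h r M \<longleftrightarrow> (\<forall>i<r. \<forall>j<n. M (i * n + j) \<le> 1) \<and> (\<forall>i<r. card (hedge n M i) = h) \<and>
    inj_on (hedge n M) {..<r}"

definition swp :: "'a \<Rightarrow> 'a \<Rightarrow> 'a set \<Rightarrow> 'a set" where
  "swp a b S = insert b (S - {a})"

definition deg :: "nat \<Rightarrow> nat \<Rightarrow> (nat \<Rightarrow> nat) \<Rightarrow> nat \<Rightarrow> nat" where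
  "deg n m M j = card {i. i < m \<and> j \<in> hedge n M i}"

lemma hedge_subset: "hedge n M i \<subseteq> {..<n}"
  by (auto simp: hedge_def)

lemma finite_hedge [simp]: "finite (hedge n M i)"
  using finite_subset[OF hedge_subset] by blast

lemma card_swp: "finite S \<Longrightarrow> a \<in> S \<Longrightarrow> b \<notin> S \<Longrightarrow> card (swp a b S) = card S"
  using card.remove[of S a] by (simp add: swp_def)

lemma cell_less: "i < r \<Longrightarrow> j < n \<Longrightarrow> i * n + j < r * (n::nat)"
proof -
  assume "i < r" "j < n"
  then have "i * n + j < Suc i * n" by simp
  also have "\<dots> \<le> r * n" using \<open>i < r\<close> by (intro mult_right_mono) auto
  finally show ?thesis .
qed

lemma cell_eq_iff:
  assumes "j < n" "j' < n"
  shows "i * n + j = i' * n + j' \<longleftrightarrow> i = i' \<and> j = (j'::nat)"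
proof
  assume *: "i * n + j = i' * n + j'"
  have "i = (i * n + j) div n" using assms by simp
  also have "\<dots> = i'" unfolding * using assms by simp
  finally show "i = i' \<and> j = j'" using * by simp
qed simp

lemma hedge_cong: "(\<And>j. j < n \<Longrightarrow> M (i * n + j) = M' (i' * n + j)) \<Longrightarrow> hedge n M i = hedge n M' i'"
  by (auto simp: hedge_def)

text \<open>Row \<open>r\<close> begins at address \<open>r * n\<close>, so a candidate written
  there touches no row in use. The other \<open>_agree\<close> lemmas rest on this one.\<close>

lemma hedge_agree:
  assumes "\<And>x. x < r * n \<Longrightarrow> M' x = M x" "i < r"
  shows "hedge n M' i = hedge n M i"
  using assms cell_less[of i r _ n] by (intro hedge_cong) auto

lemma family_agree:
  assumes "\<And>x. x < r * n \<Longrightarrow> M' x = M x"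
  shows "family n h r M' = family n h r M"
proof -
  have "M' (i * n + j) = M (i * n + j)" if "i < r" "j < n" for i j
    using assms cell_less[OF that] by blast
  moreover have "hedge n M' i = hedge n M i" if "i < r" for i
    using hedge_agree assms that by blast
  moreover from this have "inj_on (hedge n M') {..<r} = inj_on (hedge n M) {..<r}"
    by (intro inj_on_cong) auto
  ultimately show ?thesis by (simp add: family_def)
qed

section \<open>Families closed under swaps\<close>

text \<open>Any \<open>h\<close>-set \<open>T\<close> of vertices is reached from any edge by
  repeatedly swapping a vertex outside \<open>T\<close> for a missing vertex of \<open>T\<close>;
  each swap lowers \<open>card (hedge n M i - T)\<close> by one. So every \<open>h\<close>-set
  occurs among the \<open>r\<close> rows.\<close>

lemma family_card_le:
  assumes "family n h r M"
    and ne: "0 < r"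
    and closed: "\<And>i a b. \<lbrakk>i < r; a < n; b < n; a \<in> hedge n M i; b \<notin> hedge n M i\<rbrakk> \<Longrightarrow>
      swp a b (hedge n M i) \<in> hedge n M ` {..<r}"
  shows "n choose h \<le> r"
proof -
  have card: "card (hedge n M i) = h" if "i < r" for i using assms(1) that by (simp add: family_def)
  have "T \<in> hedge n M ` {..<r}" if T: "T \<subseteq> {..<n}" "card T = h" for T
  proof -
    have "T \<in> hedge n M ` {..<r}" if "i < r" "card (hedge n M i - T) = d" for i d
      using that
    proof (induction d arbitrary: i)
      case 0
      then have "hedge n M i \<subseteq> T" by simp
      moreover have "finite T" using T finite_subset by blast
      ultimately have "hedge n M i = T" using card[OF 0(1)] T(2) card_subset_eq by metis
      with 0(1) show ?case by blast
    next
      case (Suc d)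
      have fT: "finite T" using T finite_subset by blast
      from Suc.prems(2) have "hedge n M i - T \<noteq> {}" by force
      then obtain a where a: "a \<in> hedge n M i" "a \<notin> T" by blast
      \<comment> \<open>Both sets have \<open>h\<close> elements, so inclusion would be equality and
        would put \<open>a\<close> into \<open>T\<close>.\<close>
      have "\<not> T \<subseteq> hedge n M i"
        using a card[OF Suc.prems(1)] T(2) card_subset_eq[of "hedge n M i" T] by auto
      then obtain b where b: "b \<in> T" "b \<notin> hedge n M i" by blast
      have "a < n" using a hedge_subset by blast
      have "b < n" using b T by blast
      from closed[OF Suc.prems(1) \<open>a < n\<close> \<open>b < n\<close> a(1) b(2)] obtain k
        where k: "k < r" "hedge n M k = swp a b (hedge n M i)" by auto
      have "hedge n M k - T = (hedge n M i - T) - {a}" using a b by (auto simp: k swp_def)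
      then have "card (hedge n M k - T) = d" using a Suc.prems(2) by simp
      with Suc.IH k(1) show ?case by blast
    qed
    with ne show ?thesis by blast
  qed
  then have "{T. T \<subseteq> {..<n} \<and> card T = h} \<subseteq> hedge n M ` {..<r}" by blast
  from card_mono[OF _ this] have "n choose h \<le> card (hedge n M ` {..<r})"
    by (simp add: n_subsets)
  also have "\<dots> \<le> r" using card_image_le[of "{..<r}"] by simp
  finally show ?thesis .
qed

text \<open>Swapping \<open>a\<close> for \<open>b\<close> maps the edges with only \<open>a\<close>
  (\<open>A\<close>) injectively to edges with only \<open>b\<close> (\<open>B\<close>), while the
  edges with both (\<open>C\<close>) count equally for the two degrees.\<close>

lemma deg_le:
  assumes fam: "family n h m M"
    and ab: "a < n" "b < n"
    and closed: "\<And>i. \<lbrakk>i < m; a \<in> hedge n M i; b \<notin> hedge n M i\<rbrakk> \<Longrightarrow>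
      swp a b (hedge n M i) \<in> hedge n M ` {..<m}"
  shows "deg n m M a \<le> deg n m M b"
proof -
  define A where "A = {i. i < m \<and> a \<in> hedge n M i \<and> b \<notin> hedge n M i}"
  define B where "B = {i. i < m \<and> b \<in> hedge n M i \<and> a \<notin> hedge n M i}"
  define C where "C = {i. i < m \<and> a \<in> hedge n M i \<and> b \<in> hedge n M i}"
  have fin: "finite A" "finite B" "finite C" by (auto simp: A_def B_def C_def)
  have inj: "inj_on (hedge n M) {..<m}" using fam by (simp add: family_def)
  have "inj_on (\<lambda>i. swp a b (hedge n M i)) A"
  proof (rule inj_onI)
    fix i i' assume *: "i \<in> A" "i' \<in> A" "swp a b (hedge n M i) = swp a b (hedge n M i')"
    \<comment> \<open>The reverse swap recovers the original edge, which gives injectivity.\<close>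
    have "hedge n M i = swp b a (swp a b (hedge n M i))" "hedge n M i' = swp b a (swp a b (hedge n M i'))"
      using *(1,2) by (auto simp: A_def swp_def)
    with *(3) have "hedge n M i = hedge n M i'" by simp
    with inj *(1,2) show "i = i'" by (auto simp: A_def dest: inj_onD)
  qed
  then have "card A = card ((\<lambda>i. swp a b (hedge n M i)) ` A)" by (simp add: card_image)
  also have "\<dots> \<le> card (hedge n M ` B)"
  proof (rule card_mono)
    show "(\<lambda>i. swp a b (hedge n M i)) ` A \<subseteq> hedge n M ` B"
    proof
      fix S assume "S \<in> (\<lambda>i. swp a b (hedge n M i)) ` A"
      then obtain i where i: "i \<in> A" "S = swp a b (hedge n M i)" by blast
      with closed[of i] obtain k where "k < m" "S = hedge n M k" by (auto simp: A_def)
      moreover have "b \<in> S" "a \<notin> S" using i by (auto simp: A_def swp_def)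
      ultimately show "S \<in> hedge n M ` B" by (auto simp: B_def)
    qed
  qed (use fin in simp)
  also have "\<dots> \<le> card B" using fin by (simp add: card_image_le)
  finally have "card A \<le> card B" .
  moreover have "deg n m M a = card A + card C"
    unfolding deg_def using fin
    by (subst card_Un_disjoint[symmetric]) (auto simp: A_def C_def intro!: arg_cong[where f = card])
  moreover have "deg n m M b = card B + card C"
    unfolding deg_def using fin
    by (subst card_Un_disjoint[symmetric]) (auto simp: B_def C_def intro!: arg_cong[where f = card])
  ultimately show ?thesis by simp
qed

lemma sum_indicator_le_1:
  assumes "finite A" "\<And>x. x \<in> A \<Longrightarrow> f x \<le> (1::nat)"
  shows "sum f A = card {x \<in> A. f x = 1}"
proof -
  have "f x = of_bool (f x = 1)" if "x \<in> A" for x using assms(2)[OF that] by (cases "f x") auto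
  then have "sum f A = (\<Sum>x\<in>A. of_bool (f x = 1))" by (intro sum.cong) auto
  also have "\<dots> = card {x \<in> A. f x = 1}" using assms(1) by (simp add: Int_def)
  finally show ?thesis .
qed

lemma deg_eq_sum:
  assumes "family n h m M" "j < n"
  shows "deg n m M j = (\<Sum>i<m. M (i * n + j))"
  using assms
  by (subst sum_indicator_le_1) (auto simp: family_def deg_def hedge_def intro!: arg_cong[where f = card])

lemma card_hedge_eq_sum:
  assumes "family n h m M" "i < m"
  shows "h = (\<Sum>j<n. M (i * n + j))"
proof -
  have "h = card (hedge n M i)" using assms by (simp add: family_def)
  also have "\<dots> = (\<Sum>j<n. M (i * n + j))"
    using assms by (subst sum_indicator_le_1) (auto simp: family_def hedge_def intro!: arg_cong[where f = card])
  finally show ?thesis .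
qed

text \<open>Double counting of the incidences, by columns and by rows.\<close>

lemma sum_deg:
  assumes "family n h m M"
  shows "(\<Sum>j<n. deg n m M j) = m * h"
proof -
  have "(\<Sum>j<n. deg n m M j) = (\<Sum>j<n. \<Sum>i<m. M (i * n + j))"
    using assms by (intro sum.cong) (auto simp: deg_eq_sum)
  also have "\<dots> = (\<Sum>i<m. \<Sum>j<n. M (i * n + j))" by (rule sum.swap)
  also have "\<dots> = (\<Sum>i<m. h)"
    using card_hedge_eq_sum[OF assms] by (intro sum.cong) auto
  finally show ?thesis by simp
qed

section \<open>Effect of a single swap\<close>

lemma hedge_swap:
  assumes "i < m" "a < n" "b < n" "a \<noteq> b" "i' < m"
  shows "hedge n (M(i * n + a := 0, i * n + b := 1)) i' =
    (if i' = i then swp a b (hedge n M i) else hedge n M i')"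
  using assms by (auto simp: hedge_def swp_def cell_eq_iff)

lemma family_swap:
  assumes fam: "family n h m M" and i: "i < m" "a < n" "b < n"
    and ab: "a \<in> hedge n M i" "b \<notin> hedge n M i"
    and new: "swp a b (hedge n M i) \<notin> hedge n M ` {..<m}"
  shows "family n h m (M(i * n + a := 0, i * n + b := 1))"
proof -
  have ne: "a \<noteq> b" using ab by blast
  define M' where "M' = M(i * n + a := 0, i * n + b := 1)"
  have sw: "hedge n M' k = (if k = i then swp a b (hedge n M i) else hedge n M k)" if "k < m" for k
    unfolding M'_def using hedge_swap[OF i ne that] .
  have "inj_on (hedge n M') {..<m}"
  proof (rule inj_onI)
    fix k l assume *: "k \<in> {..<m}" "l \<in> {..<m}" "hedge n M' k = hedge n M' l"
    have old: "swp a b (hedge n M i) \<noteq> hedge n M j" if "j < m" for j using new that by blast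
    have inj: "inj_on (hedge n M) {..<m}" using fam by (simp add: family_def)
    show "k = l"
    proof (cases "k = i \<or> l = i")
      case True
      then show ?thesis using * old[of k] old[of l] by (auto simp: sw split: if_splits)
    next
      case False
      then have "hedge n M k = hedge n M l" using * by (simp add: sw)
      with inj *(1,2) show ?thesis by (auto dest: inj_onD)
    qed
  qed
  moreover have "card (hedge n M' k) = h" if "k < m" for k
    using that fam i ab by (simp add: sw family_def card_swp)
  moreover have "M' (k * n + j) \<le> 1" if "k < m" "j < n" for k j
    using that fam by (simp add: family_def M'_def)
  ultimately show ?thesis unfolding M'_def[symmetric] by (simp add: family_def)
qed

text \<open>Since edge \<open>i\<close> contains \<open>a\<close>, the degree of \<open>a\<close> is
  positive and the subtraction does not truncate.\<close>

lemma deg_swap: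
  assumes i: "i < m" "a < n" "b < n"
    and ab: "a \<in> hedge n M i" "b \<notin> hedge n M i"
  shows "deg n m (M(i * n + a := 0, i * n + b := 1)) j =
    (if j = a then deg n m M a - 1 else if j = b then deg n m M b + 1 else deg n m M j)"
proof -
  have ne: "a \<noteq> b" using ab by blast
  define M' where "M' = M(i * n + a := 0, i * n + b := 1)"
  have sw: "hedge n M' k = (if k = i then swp a b (hedge n M i) else hedge n M k)" if "k < m" for k
    unfolding M'_def using hedge_swap[OF i ne that] .
  let ?D = "\<lambda>M j. {i. i < m \<and> j \<in> hedge n M i}"
  consider "j = a" | "j = b" | "j \<noteq> a" "j \<noteq> b" by blast
  then show ?thesis
  proof cases
    case 1
    have "?D M' a = ?D M a - {i}" using ne by (auto simp: sw swp_def split: if_splits)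
    with 1 i ab show ?thesis unfolding M'_def[symmetric] by (simp add: deg_def)
  next
    case 2
    have "?D M' b = insert i (?D M b)" using ne i by (auto simp: sw swp_def split: if_splits)
    with 2 i ab ne show ?thesis unfolding M'_def[symmetric] by (simp add: deg_def)
  next
    case 3
    have "?D M' j = ?D M j" using 3 by (auto simp: sw swp_def split: if_splits)
    with 3 show ?thesis unfolding M'_def[symmetric] by (simp add: deg_def)
  qed
qed

section \<open>Growing the family by breadth-first search\<close>

lemma family_Suc:
  assumes "family n h r M" "\<And>j. j < n \<Longrightarrow> M (r * n + j) \<le> 1" "card (hedge n M r) = h"
    "hedge n M r \<notin> hedge n M ` {..<r}"
  shows "family n h (Suc r) M"
  using assms by (auto simp: family_def less_Suc_eq lessThan_Suc)

text \<open>Invariant of the search, which runs through the triples \<open>(i, a, b)\<close>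
  lexicographically. The rows themselves form the queue: row \<open>i\<close> is being expanded, and
  \<open>i < r\<close> says that the queue is not exhausted. Once \<open>r = m\<close> the search
  idles, and closure under swaps is no longer claimed.\<close>

definition grown :: "nat \<Rightarrow> nat \<Rightarrow> nat \<Rightarrow> nat \<Rightarrow> nat \<Rightarrow> nat \<Rightarrow> nat \<Rightarrow> (nat \<Rightarrow> nat) \<Rightarrow> bool" where
  "grown n h m i a b r M \<longleftrightarrow> family n h r M \<and> r \<le> m \<and>
    (r = m \<or> i < r \<and> (\<forall>i' a' b'. a' < n \<longrightarrow> b' < n \<longrightarrow>
      i' < i \<or> i' = i \<and> (a' < a \<or> a' = a \<and> b' < b) \<longrightarrow>
      a' \<in> hedge n M i' \<longrightarrow> b' \<notin> hedge n M i' \<longrightarrow>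
      swp a' b' (hedge n M i') \<in> hedge n M ` {..<r}))"

lemma grown_known:
  assumes "grown n h m i a b r M"
    and "\<lbrakk>r < m; a \<in> hedge n M i; b \<notin> hedge n M i\<rbrakk> \<Longrightarrow>
      swp a b (hedge n M i) \<in> hedge n M ` {..<r}"
  shows "grown n h m i a (Suc b) r M"
proof (cases "r = m")
  case True
  with assms show ?thesis by (simp add: grown_def)
next
  case False
  with assms(1) have "r < m" by (auto simp: grown_def)
  with assms show ?thesis unfolding grown_def less_Suc_eq by blast
qed

lemma image_hedge_agree:
  assumes "\<And>x. x < r * n \<Longrightarrow> M' x = M x"
  shows "hedge n M' ` {..<r} = hedge n M ` {..<r}"
  using hedge_agree[of r n M' M, OF assms] by (intro image_cong) auto

lemma grown_swp:
  assumes "grown n h m i a b r M" "r \<noteq> m" "a' < n" "b' < n"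
    "i' < i \<or> i' = i \<and> (a' < a \<or> a' = a \<and> b' < b)"
    "a' \<in> hedge n M i'" "b' \<notin> hedge n M i'"
  shows "swp a' b' (hedge n M i') \<in> hedge n M ` {..<r}"
  using assms unfolding grown_def by blast

lemma grown_agree:
  assumes g: "grown n h m i a b r M" and M': "\<And>x. x < r * n \<Longrightarrow> M' x = M x"
  shows "grown n h m i a b r M'"
proof -
  have same: "hedge n M' i' = hedge n M i'" if "i' < r" for i'
    using hedge_agree[of r n M' M, OF M' that] .
  have fam: "family n h r M'" using g family_agree[of r n M' M, OF M'] by (simp add: grown_def)
  show ?thesis
  proof (cases "r = m")
    case True
    with g fam show ?thesis by (simp add: grown_def)
  next
    case False
    with g have r: "r < m" "i < r" by (auto simp: grown_def)
    have "swp a' b' (hedge n M' i') \<in> hedge n M' ` {..<r}"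
      if "a' < n" "b' < n" "i' < i \<or> i' = i \<and> (a' < a \<or> a' = a \<and> b' < b)"
        "a' \<in> hedge n M' i'" "b' \<notin> hedge n M' i'" for i' a' b'
    proof -
      have "i' < r" using that(3) r(2) by linarith
      then show ?thesis
        using grown_swp[OF g False that(1-3)] that(4,5) image_hedge_agree[of r n M' M, OF M']
        by (simp add: same)
    qed
    with fam r show ?thesis by (simp add: grown_def)
  qed
qed

text \<open>Earlier swaps stay inside the family because it only grows, and the appended row is
  itself the result of the current swap.\<close>

lemma grown_new:
  assumes g: "grown n h m i a b r M"
    and r: "r < m"
    and ab: "a \<in> hedge n M i" "b \<notin> hedge n M i"
    and M': "\<And>x. x < r * n \<Longrightarrow> M' x = M x" "\<And>j. j < n \<Longrightarrow> M' (r * n + j) \<le> 1"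
    and new: "hedge n M' r = swp a b (hedge n M i)" "swp a b (hedge n M i) \<notin> hedge n M ` {..<r}"
  shows "grown n h m i a (Suc b) (Suc r) M'"
proof -
  have g': "grown n h m i a b r M'" using grown_agree[OF g M'(1)] .
  have i: "i < r" using g r by (auto simp: grown_def)
  have same: "hedge n M' i' = hedge n M i'" if "i' < r" for i'
    using hedge_agree[of r n M' M, OF M'(1) that] .
  have "card (hedge n M i) = h" using g i by (simp add: grown_def family_def)
  then have "family n h (Suc r) M'"
    using g' new ab M' by (intro family_Suc) (simp_all add: grown_def card_swp image_hedge_agree[of r n M' M])
  moreover have "swp a' b' (hedge n M' i') \<in> hedge n M' ` {..<Suc r}"
    if "a' < n" "b' < n" "i' < i \<or> i' = i \<and> (a' < a \<or> a' = a \<and> b' < Suc b)"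
      "a' \<in> hedge n M' i'" "b' \<notin> hedge n M' i'" for i' a' b'
  proof (cases "i' = i \<and> a' = a \<and> b' = b")
    case True
    then show ?thesis using new(1) same[OF i] by auto
  next
    case False
    with that(3) have "i' < i \<or> i' = i \<and> (a' < a \<or> a' = a \<and> b' < b)" by linarith
    then have "swp a' b' (hedge n M' i') \<in> hedge n M' ` {..<r}"
      using grown_swp[OF g' _ that(1,2) _ that(4,5)] r by blast
    then show ?thesis by auto
  qed
  ultimately show ?thesis using r i by (simp add: grown_def)
qed

lemma grown_next_vertex: "grown n h m i a n r M \<Longrightarrow> grown n h m i (Suc a) 0 r M"
  unfolding grown_def less_Suc_eq by blast

text \<open>If the queue ran dry with \<open>r < m\<close>, the family would be closed under all
  swaps, and \<open>family_card_le\<close> would give at least \<open>n choose h\<close> rows, hence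
  at least \<open>m\<close>.\<close>

lemma grown_next_row:
  assumes g: "grown n h m i n 0 r M" and m: "m \<le> n choose h"
  shows "grown n h m (Suc i) 0 0 r M"
proof (cases "r = m")
  case True
  with g show ?thesis by (simp add: grown_def)
next
  case False
  with g have fam: "family n h r M" and r: "r < m" "i < r"
    and closed: "\<And>i' a' b'. \<lbrakk>i' \<le> i; a' < n; b' < n; a' \<in> hedge n M i'; b' \<notin> hedge n M i'\<rbrakk> \<Longrightarrow>
      swp a' b' (hedge n M i') \<in> hedge n M ` {..<r}"
    by (auto simp: grown_def le_less)
  have "Suc i \<noteq> r"
  proof
    assume "Suc i = r"
    then have "n choose h \<le> r" using closed by (intro family_card_le[OF fam]) auto
    with m r show False by simp
  qed
  with r have "Suc i < r" by simp
  with fam r closed show ?thesis by (simp add: grown_def)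
qed

section \<open>Correcting the degrees in one pass\<close>

text \<open>Here \<open>W\<close> gives the prescribed degrees. Pairs lexicographically before
  \<open>(a, b)\<close> are settled; for the current pair, if it is still unsettled, every swap in a
  row before \<open>i\<close> is blocked by an existing edge.\<close>

definition balanced :: "nat \<Rightarrow> nat \<Rightarrow> nat \<Rightarrow> (nat \<Rightarrow> nat) \<Rightarrow> nat \<Rightarrow> nat \<Rightarrow> nat \<Rightarrow> (nat \<Rightarrow> nat) \<Rightarrow> bool" where
  "balanced n h m W a b i M \<longleftrightarrow> family n h m M \<and>
    (\<forall>a' b'. a' < n \<longrightarrow> b' < n \<longrightarrow> a' < a \<or> a' = a \<and> b' < b \<longrightarrow>
      deg n m M a' \<le> W a' \<or> W b' \<le> deg n m M b') \<and>
    (W a < deg n m M a \<longrightarrow> deg n m M b < W b \<longrightarrow>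
      (\<forall>i'<i. a \<in> hedge n M i' \<longrightarrow> b \<notin> hedge n M i' \<longrightarrow>
        swp a b (hedge n M i') \<in> hedge n M ` {..<m}))"

lemma deg_agree:
  assumes "\<And>x. x < m * n \<Longrightarrow> M' x = M x"
  shows "deg n m M' j = deg n m M j"
proof -
  have "hedge n M' i = hedge n M i" if "i < m" for i
    using hedge_agree[of m n M' M, OF assms that] .
  then show ?thesis unfolding deg_def by (intro arg_cong[where f = card]) auto
qed

lemma balanced_agree:
  assumes "balanced n h m W a b i M" "i \<le> m" and M': "\<And>x. x < m * n \<Longrightarrow> M' x = M x"
  shows "balanced n h m W a b i M'"
proof -
  have "hedge n M' i' = hedge n M i'" if "i' < i" for i'
    using hedge_agree[of m n M' M i', OF M'] that assms(2) by simp
  with assms(1) show ?thesis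
    unfolding balanced_def
    by (simp add: family_agree[of m n M' M, OF M'] deg_agree[of m n M' M, OF M']
        image_hedge_agree[of m n M' M, OF M'])
qed

lemma balanced_known:
  assumes "balanced n h m W a b i M"
    and "\<lbrakk>W a < deg n m M a; deg n m M b < W b; a \<in> hedge n M i; b \<notin> hedge n M i\<rbrakk> \<Longrightarrow>
      swp a b (hedge n M i) \<in> hedge n M ` {..<m}"
  shows "balanced n h m W a b (Suc i) M"
  using assms unfolding balanced_def less_Suc_eq by blast

text \<open>One degree above its target drops by one and one below its target rises by one. Neither
  crosses its target, so settled pairs stay settled; it remains to see that blocked swaps stay
  blocked.\<close>

lemma balanced_swap:
  assumes bal: "balanced n h m W a b i M"
    and i: "i < m" "a < n" "b < n"
    and ab: "a \<in> hedge n M i" "b \<notin> hedge n M i"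
    and deg: "W a < deg n m M a" "deg n m M b < W b"
    and new: "swp a b (hedge n M i) \<notin> hedge n M ` {..<m}"
  shows "balanced n h m W a b (Suc i) (M(i * n + a := 0, i * n + b := 1))"
proof -
  define M' where "M' = M(i * n + a := 0, i * n + b := 1)"
  have ne: "a \<noteq> b" using ab by blast
  have sw: "hedge n M' k = (if k = i then swp a b (hedge n M i) else hedge n M k)" if "k < m" for k
    unfolding M'_def using hedge_swap[OF i ne that] .
  have dg: "deg n m M' j =
    (if j = a then deg n m M a - 1 else if j = b then deg n m M b + 1 else deg n m M j)" for j
    unfolding M'_def using deg_swap[OF i ab] .
  have fam: "family n h m M" using bal by (simp add: balanced_def)
  have "family n h m M'" unfolding M'_def using family_swap[OF fam i ab new] .
  moreover have "deg n m M' a' \<le> W a' \<or> W b' \<le> deg n m M' b'"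
    if "a' < n" "b' < n" "a' < a \<or> a' = a \<and> b' < b" for a' b'
  proof -
    have "deg n m M a' \<le> W a' \<or> W b' \<le> deg n m M b'"
      using bal that unfolding balanced_def by blast
    with deg ne show ?thesis by (auto simp: dg)
  qed
  moreover have "swp a b (hedge n M' i') \<in> hedge n M' ` {..<m}"
    if i': "i' < Suc i" "a \<in> hedge n M' i'" "b \<notin> hedge n M' i'" for i'
  proof -
    have m: "i' < m" using i' i by simp
    \<comment> \<open>The rewritten edge \<open>i\<close> contains \<open>b\<close>.\<close>
    have "i' \<noteq> i" using i' i by (auto simp: sw swp_def)
    with i' m have *: "i' < i" "hedge n M' i' = hedge n M i'" by (simp_all add: sw)
    with i' bal deg have "swp a b (hedge n M i') \<in> hedge n M ` {..<m}"
      unfolding balanced_def by simp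
    then obtain k where k: "k < m" "swp a b (hedge n M i') = hedge n M k" by auto
    \<comment> \<open>The swapped copy of edge \<open>i'\<close> contains \<open>b\<close>, so it is not the edge that has just been replaced.\<close>
    have "b \<in> hedge n M k" using k(2) by (metis insertI1 swp_def)
    with ab have "k \<noteq> i" by blast
    with k * show ?thesis by (auto simp: sw intro!: image_eqI[of _ _ k])
  qed
  ultimately show ?thesis unfolding M'_def[symmetric] by (simp add: balanced_def)
qed

text \<open>If the pair were still unsettled, all swaps would be blocked and \<open>deg_le\<close>
  would bound the degree of \<open>a\<close> by that of \<open>b\<close>. But the degree of
  \<open>b\<close> is below \<open>W b\<close>, hence at most \<open>W a\<close>, which is less than
  the degree of \<open>a\<close>.\<close>

lemma balanced_next_pair:
  assumes bal: "balanced n h m W a b m M" and ab: "a < n" "b < n" and W: "W b \<le> W a + 1"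
  shows "balanced n h m W a (Suc b) 0 M"
proof -
  have "deg n m M a \<le> W a \<or> W b \<le> deg n m M b"
  proof (rule ccontr)
    assume *: "\<not> ?thesis"
    with bal have "deg n m M a \<le> deg n m M b"
      by (intro deg_le[OF _ ab]) (auto simp: balanced_def)
    with * W show False by simp
  qed
  with bal show ?thesis unfolding balanced_def less_Suc_eq by blast
qed

lemma balanced_next_vertex: "balanced n h m W a n 0 M \<Longrightarrow> balanced n h m W (Suc a) 0 0 M"
  unfolding balanced_def less_Suc_eq by blast

text \<open>With all pairs settled, either no vertex exceeds its target or none falls short of it.
  Since the totals agree, a one-sided inequality is an equality everywhere.\<close>

lemma balanced_final:
  assumes bal: "balanced n h m W n 0 0 M" and sum: "(\<Sum>j<n. W j) = m * h" and j: "j < n"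
  shows "deg n m M j = W j"
proof -
  have eq: "(\<Sum>j<n. deg n m M j) = (\<Sum>j<n. W j)"
    using bal sum sum_deg[of n h m M] by (simp add: balanced_def)
  have *: "deg n m M a \<le> W a \<or> W b \<le> deg n m M b" if "a < n" "b < n" for a b
    using bal that by (simp add: balanced_def)
  show ?thesis
  proof (cases "\<forall>a<n. deg n m M a \<le> W a")
    case True
    show ?thesis
      by (rule sum_mono_inv[OF eq]) (use True j in auto)
  next
    case False
    with * have "\<forall>b<n. W b \<le> deg n m M b" by blast
    then show ?thesis
      using sum_mono_inv[OF eq[symmetric], of j] j by auto
  qed
qed

section \<open>The program\<close>

text \<open>
  The registers \<open>rr\<close> and \<open>rq\<close> hold the number of rows in use and the address of the next row.
  The pairs \<open>ri\<close>, \<open>rp\<close> and \<open>rl\<close>, \<open>ru\<close> hold the number and the address of a row; \<open>rf\<close> counts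
  the rows equal to the candidate row, \<open>re\<close> is the distance of two rows, and \<open>rx\<close>, \<open>ry\<close> are the
  degrees of the vertices in \<open>ra\<close>, \<open>rb\<close>. The input \<open>V\<close> is represented by \<open>rv\<close> and the number \<open>rk\<close>
  of leading entries equal to \<open>v\<close>, since the output overwrites it.
\<close>

abbreviation "rm \<equiv> 2 :: nat"
abbreviation "rn \<equiv> 3 :: nat"
abbreviation "rh \<equiv> 4 :: nat"
abbreviation "rv \<equiv> 5 :: nat"
abbreviation "rk \<equiv> 6 :: nat"
abbreviation "rr \<equiv> 7 :: nat"
abbreviation "rq \<equiv> 8 :: nat"
abbreviation "ri \<equiv> 9 :: nat"
abbreviation "rp \<equiv> 10 :: nat"
abbreviation "ra \<equiv> 11 :: nat"
abbreviation "rb \<equiv> 12 :: nat"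
abbreviation "rf \<equiv> 13 :: nat"
abbreviation "rj \<equiv> 14 :: nat"
abbreviation "rl \<equiv> 15 :: nat"
abbreviation "ru \<equiv> 16 :: nat"
abbreviation "re \<equiv> 17 :: nat"
abbreviation "rx \<equiv> 18 :: nat"
abbreviation "ry \<equiv> 19 :: nat"

abbreviation cell :: "nat \<Rightarrow> nat \<Rightarrow> expr" where
  "cell p j \<equiv> Mem (Add (Reg p) (Reg j))"

section \<open>Building and testing a candidate row\<close>

definition incr :: "nat \<Rightarrow> expr \<Rightarrow> com" where
  "incr x e = Assign x (Add (Reg x) e)"

definition copy :: com where
  "copy = For rj rn (Store (Add (Reg rq) (Reg rj)) (cell rp rj))"

text \<open>Of the two truncated differences one is zero, so their sum is the absolute difference of
  the entries.\<close>

definition compare :: com where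
  "compare = Assign re (Const 0) ;;
    For rj rn (incr re (Add (Sub (cell ru rj) (cell rq rj)) (Sub (cell rq rj) (cell ru rj))))"

text \<open>The truncated \<open>1 - re\<close> is the indicator that the two rows agree. The
  address \<open>ru\<close> advances by \<open>n\<close> per row because the machine cannot
  multiply.\<close>

definition search :: com where
  "search = copy ;; Store (Add (Reg rq) (Reg ra)) (Const 0) ;; Store (Add (Reg rq) (Reg rb)) (Const 1) ;;
    Assign rf (Const 0) ;; Assign ru (Const 0) ;;
    For rl rr (compare ;; incr rf (Sub (Const 1) (Reg re)) ;; incr ru (Reg rn))"

text \<open>The source row ends before the destination begins, so no overwritten cell is
  read.\<close>

lemma wp_copy:
  assumes "n \<le> N" "R rn = n" "R rp + n \<le> R rq"
    and Q: "\<And>R' M'. \<lbrakk>\<And>z. z \<noteq> rj \<Longrightarrow> R' z = R z;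
      M' = (\<lambda>x. if R rq \<le> x \<and> x < R rq + n then M (R rp + (x - R rq)) else M x)\<rbrakk> \<Longrightarrow> Q (R', M')"
  shows "wp N copy Q (R, M)"
  unfolding copy_def
proof (rule wp_For[where K = n and I = "\<lambda>k R' M'.
    M' = (\<lambda>x. if R rq \<le> x \<and> x < R rq + k then M (R rp + (x - R rq)) else M x)"])
  fix k R' M'
  assume *: "k < n" "R' rj = k"
    "\<And>z. z \<notin> insert rj (mods (Store (Add (Reg rq) (Reg rj)) (cell rp rj))) \<Longrightarrow> R' z = R z"
    "M' = (\<lambda>x. if R rq \<le> x \<and> x < R rq + k then M (R rp + (x - R rq)) else M x)"
  have "M' (R rp + k) = M (R rp + k)" using * assms(3) by simp
  with * show "wp N (Store (Add (Reg rq) (Reg rj)) (cell rp rj))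
    (\<lambda>s. snd s = (\<lambda>x. if R rq \<le> x \<and> x < R rq + Suc k then M (R rp + (x - R rq)) else M x)) (R', M')"
    by (auto simp: fun_eq_iff)
qed (use assms in auto)

lemma wp_compare:
  assumes "n \<le> N" "R rn = n"
    and Q: "\<And>R'. \<lbrakk>\<And>z. z \<notin> {rj, re} \<Longrightarrow> R' z = R z;
      R' re = 0 \<longleftrightarrow> (\<forall>j<n. M (R ru + j) = M (R rq + j))\<rbrakk> \<Longrightarrow> Q (R', M)"
  shows "wp N compare Q (R, M)"
proof -
  let ?c = "incr re (Add (Sub (cell ru rj) (cell rq rj)) (Sub (cell rq rj) (cell ru rj)))"
  have "wp N (For rj rn ?c) Q (R(re := 0), M)"
  proof (rule wp_For[where K = n and I = "\<lambda>k R' M'. M' = M \<and>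
      (R' re = 0 \<longleftrightarrow> (\<forall>j<k. M (R ru + j) = M (R rq + j)))"])
    fix k R' M'
    assume "k < n" "R' rj = k" "\<And>z. z \<notin> insert rj (mods ?c) \<Longrightarrow> R' z = (R(re := 0)) z"
      "M' = M \<and> (R' re = 0 \<longleftrightarrow> (\<forall>j<k. M (R ru + j) = M (R rq + j)))"
    then show "wp N ?c (\<lambda>s. snd s = M \<and>
      (((fst s)(rj := Suc k)) re = 0 \<longleftrightarrow> (\<forall>j<Suc k. M (R ru + j) = M (R rq + j)))) (R', M')"
      by (auto simp: incr_def less_Suc_eq)
  qed (use assms in \<open>auto simp: incr_def\<close>)
  then show ?thesis by (simp add: compare_def)
qed

lemma mods_compare: "mods compare = {rj, re}"
  by (auto simp: compare_def incr_def)

lemma wp_search: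
  assumes N: "n \<le> N" "r \<le> N"
    and R: "R rn = n" "R rr = r" "R rq = r * n" "R rp = i * n" "R ra = a" "R rb = b"
    and i: "i < r" "a < n" "b < n"
    and fam: "family n h r M"
    and ab: "a \<in> hedge n M i" "b \<notin> hedge n M i"
    and Q: "\<And>R' M'. \<lbrakk>\<And>z. z \<notin> {rj, re, rf, rl, ru} \<Longrightarrow> R' z = R z; \<And>x. x < r * n \<Longrightarrow> M' x = M x;
      \<And>j. j < n \<Longrightarrow> M' (r * n + j) \<le> 1; hedge n M' r = swp a b (hedge n M i);
      R' rf = 0 \<longleftrightarrow> swp a b (hedge n M i) \<notin> hedge n M ` {..<r}\<rbrakk> \<Longrightarrow> Q (R', M')"
  shows "wp N search Q (R, M)"
  unfolding search_def wp.simps(4)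
proof (rule wp_copy)
  show "n \<le> N" "R rn = n" by fact+
  have "Suc i * n \<le> r * n" using i by (intro mult_right_mono) auto
  then show "R rp + n \<le> R rq" by (simp add: R add.commute)
next
  fix R1 M1
  assume R1: "\<And>z. z \<noteq> rj \<Longrightarrow> R1 z = R z"
    and M1: "M1 = (\<lambda>x. if R rq \<le> x \<and> x < R rq + n then M (R rp + (x - R rq)) else M x)"
  define M2 where "M2 = M1(r * n + a := 0, r * n + b := 1)"
  define R2 where "R2 = R1(rf := 0, ru := 0)"
  have R2: "R2 z = R z" if "z \<notin> {rj, rf, ru}" for z using that R1 by (simp add: R2_def)
  have old: "M2 x = M x" if "x < r * n" for x using that by (simp add: M2_def M1 R)
  have row: "M2 (r * n + j) = (if j = b then 1 else if j = a then 0 else M (i * n + j))" if "j < n" for j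
    using that by (simp add: M2_def M1 R)
  have le1: "M (l * n + j) \<le> 1" if "l < r" "j < n" for l j using fam that by (simp add: family_def)
  have le1': "M2 (r * n + j) \<le> 1" if "j < n" for j using le1[OF i(1) that] row[OF that] by auto
  have new: "hedge n M2 r = swp a b (hedge n M i)"
    using i by (auto simp: hedge_def swp_def row split: if_splits)
  have same: "hedge n M2 l = hedge n M l" if "l < r" for l
    using hedge_agree[of r n M2 M, OF old that] .
  \<comment> \<open>With entries at most 1 in both rows, equality of the edges is the cellwise
    equality that \<open>compare\<close> tests.\<close>
  have eq_iff: "hedge n M2 l = hedge n M2 r \<longleftrightarrow> (\<forall>j<n. M2 (l * n + j) = M2 (r * n + j))"
    if l: "l < r" for l
  proof
    assume *: "hedge n M2 l = hedge n M2 r"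
    show "\<forall>j<n. M2 (l * n + j) = M2 (r * n + j)"
    proof (intro allI impI)
      fix j assume j: "j < n"
      have "M2 (l * n + j) \<le> 1" using le1[OF l j] old[OF cell_less[OF l j]] by simp
      moreover have "M2 (l * n + j) = 1 \<longleftrightarrow> M2 (r * n + j) = 1"
        using * j by (auto simp: hedge_def set_eq_iff)
      ultimately show "M2 (l * n + j) = M2 (r * n + j)" using le1'[OF j] by linarith
    qed
  next
    assume "\<forall>j<n. M2 (l * n + j) = M2 (r * n + j)"
    then show "hedge n M2 l = hedge n M2 r" by (intro hedge_cong) auto
  qed
  let ?c = "compare ;; incr rf (Sub (Const 1) (Reg re)) ;; incr ru (Reg rn)"
  let ?I = "\<lambda>k R' M'. M' = M2 \<and> R' ru = k * n \<and> (R' rf = 0 \<longleftrightarrow> (\<forall>l<k. hedge n M2 l \<noteq> hedge n M2 r))"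
  have "wp N (For rl rr ?c) Q (R2, M2)"
  proof (rule wp_For[where K = r and I = ?I])
    fix k R' M'
    assume k: "k < r" "R' rl = k" "\<And>z. z \<notin> insert rl (mods ?c) \<Longrightarrow> R' z = R2 z" and I: "?I k R' M'"
    have R': "R' z = R z" if "z \<notin> {rj, re, rf, rl, ru}" for z
      using that k(3)[of z] R2[of z] by (simp add: mods_compare incr_def)
    show "wp N ?c (\<lambda>s. ?I (Suc k) ((fst s)(rl := Suc k)) (snd s)) (R', M')"
      unfolding wp.simps(4)
    proof (rule wp_compare)
      fix R3
      assume R3: "\<And>z. z \<notin> {rj, re} \<Longrightarrow> R3 z = R' z"
        "R3 re = 0 \<longleftrightarrow> (\<forall>j<n. M' (R' ru + j) = M' (R' rq + j))"
      have "R3 re = 0 \<longleftrightarrow> hedge n M2 k = hedge n M2 r"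
        using R3(2) I eq_iff[OF k(1)] by (simp add: R' R)
      with I show "wp N (incr rf (Sub (Const 1) (Reg re))) (wp N (incr ru (Reg rn))
        (\<lambda>s. ?I (Suc k) ((fst s)(rl := Suc k)) (snd s))) (R3, M')"
        by (auto simp: incr_def R3(1) R' R less_Suc_eq)
    qed (use N R in \<open>simp_all add: R'\<close>)
  next
    fix R' M'
    assume *: "\<And>z. z \<notin> insert rl (mods ?c) \<Longrightarrow> R' z = R2 z" and I: "?I r R' M'"
    show "Q (R', M')"
    proof (rule Q)
      show "R' z = R z" if "z \<notin> {rj, re, rf, rl, ru}" for z
        using that *[of z] R2[of z] by (simp add: mods_compare incr_def)
      show "R' rf = 0 \<longleftrightarrow> swp a b (hedge n M i) \<notin> hedge n M ` {..<r}"
        using I same by (auto simp: new)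
    qed (use I old le1' new in auto)
  qed (use N R R2 in \<open>auto simp: mods_compare incr_def R2_def\<close>)
  then show "wp N (Store (Add (Reg rq) (Reg ra)) (Const 0)) (wp N (Store (Add (Reg rq) (Reg rb)) (Const 1))
    (wp N (Assign rf (Const 0)) (wp N (Assign ru (Const 0)) (wp N (For rl rr ?c) Q)))) (R1, M1)"
    by (simp add: R1 R R2_def M2_def)
qed

lemma mods_search: "mods search = {rj, re, rf, rl, ru}"
  by (auto simp: search_def copy_def mods_compare incr_def)

text \<open>On entries 0 and 1 the truncated difference is nonzero only for 1 minus 0.\<close>

definition guard :: expr where
  "guard = Sub (cell rp ra) (cell rp rb)"

lemma val_guard:
  assumes "family n h r M" "i < r" "a < n" "b < n" "R rp = i * n" "R ra = a" "R rb = b"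
  shows "val guard (R, M) \<noteq> 0 \<longleftrightarrow> a \<in> hedge n M i \<and> b \<notin> hedge n M i"
proof -
  have "M (i * n + a) \<le> 1" "M (i * n + b) \<le> 1" using assms by (auto simp: family_def)
  with assms show ?thesis by (auto simp: guard_def hedge_def)
qed

section \<open>The growing phase\<close>

definition extend :: com where
  "extend = If (Sub (Reg rm) (Reg rr))
    (If guard (search ;; If (Reg rf) Skip (incr rr (Const 1) ;; incr rq (Reg rn))) Skip) Skip"

lemma mods_extend: "mods extend = {rr, rq, rj, re, rf, rl, ru}"
  by (auto simp: extend_def mods_search incr_def)

lemma wp_extend:
  assumes N: "n \<le> N" "m \<le> N"
    and R: "R rn = n" "R rm = m" "R rr = r" "R rq = r * n" "R rp = i * n" "R ra = a" "R rb = b"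
    and ab: "a < n" "b < n"
    and g: "grown n h m i a b r M"
    and Q: "\<And>R' M' r'. \<lbrakk>\<And>z. z \<notin> mods extend \<Longrightarrow> R' z = R z; R' rr = r'; R' rq = r' * n;
      grown n h m i a (Suc b) r' M'\<rbrakk> \<Longrightarrow> Q (R', M')"
  shows "wp N extend Q (R, M)"
proof -
  \<comment> \<open>Covers the cases that leave the memory untouched: enough rows, or a pair
    admitting no swap. In both the premise holds vacuously.\<close>
  have known: "Q (R, M)"
    if "\<lbrakk>r < m; a \<in> hedge n M i; b \<notin> hedge n M i\<rbrakk> \<Longrightarrow> swp a b (hedge n M i) \<in> hedge n M ` {..<r}"
    by (rule Q[OF _ R(3,4) grown_known[OF g that]]) auto
  have fam: "family n h r M" and rm: "r \<le> m" using g by (auto simp: grown_def)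
  show ?thesis
  proof (cases "r < m")
    case False
    with known R show ?thesis by (simp add: extend_def)
  next
    case r: True
    with g have i: "i < r" by (auto simp: grown_def)
    note guard = val_guard[OF fam i ab R(5-7)]
    show ?thesis
    proof (cases "a \<in> hedge n M i \<and> b \<notin> hedge n M i")
      case False
      with guard known r R show ?thesis by (auto simp: extend_def)
    next
      case True
      let ?c = "If (Reg rf) Skip (incr rr (Const 1) ;; incr rq (Reg rn))"
      have "wp N search (wp N ?c Q) (R, M)"
      proof (rule wp_search[OF _ _ R(1,3,4,5,6,7) i ab fam])
        fix R' M'
        assume R': "\<And>z. z \<notin> {rj, re, rf, rl, ru} \<Longrightarrow> R' z = R z"
          and M': "\<And>x. x < r * n \<Longrightarrow> M' x = M x" "\<And>j. j < n \<Longrightarrow> M' (r * n + j) \<le> 1"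
          and new: "hedge n M' r = swp a b (hedge n M i)"
          and f: "R' rf = 0 \<longleftrightarrow> swp a b (hedge n M i) \<notin> hedge n M ` {..<r}"
        show "wp N ?c Q (R', M')"
        proof (cases "R' rf = 0")
          case False
          \<comment> \<open>A rejected candidate has still overwritten row \<open>r\<close>, so the
            invariant is transferred by agreement on the rows in use.\<close>
          have "grown n h m i a (Suc b) r M'"
            by (rule grown_agree[OF grown_known[OF g]]) (use False f M'(1) in simp_all)
          with False show ?thesis
            by (auto intro!: Q[of _ r] simp: R' R mods_extend)
        next
          case 0: True
          have "grown n h m i a (Suc b) (Suc r) M'"
            by (rule grown_new[OF g r]) (use True 0 f M' new in simp_all)
          with 0 show ?thesis
            by (auto intro!: Q[of _ "Suc r"] simp: R' R mods_extend incr_def)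
        qed
      qed (use True N rm in auto)
      with True guard r R show ?thesis by (simp add: extend_def)
    qed
  qed
qed

definition grow :: com where
  "grow = Assign rr (Const 1) ;; Assign rq (Reg rn) ;; Assign rp (Const 0) ;;
    For ri rm (For ra rn (For rb rn extend) ;; incr rp (Reg rn))"

lemma mods_grow: "mods grow = {rr, rq, rp, ri, ra, rb, rj, re, rf, rl, ru}"
  by (auto simp: grow_def mods_extend incr_def)

lemma wp_grow:
  assumes N: "n \<le> N" "m \<le> N"
    and R: "R rn = n" "R rm = m"
    and m: "0 < m" "m \<le> n choose h"
    and fam: "family n h 1 M"
    and Q: "\<And>R' M'. \<lbrakk>\<And>z. z \<notin> mods grow \<Longrightarrow> R' z = R z; R' rr = m; R' rq = m * n; family n h m M'\<rbrakk>
      \<Longrightarrow> Q (R', M')"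
  shows "wp N grow Q (R, M)"
proof -
  define R0 where "R0 = R(rr := 1, rq := n, rp := 0)"
  have R0: "R0 rn = n" "R0 rm = m" using R by (simp_all add: R0_def)
  let ?Inv = "\<lambda>i a b R' M'. R' rq = R' rr * n \<and> R' rp = i * n \<and> grown n h m i a b (R' rr) M'"
  let ?c = "For ra rn (For rb rn extend) ;; incr rp (Reg rn)"
  have "wp N (For ri rm ?c) Q (R0, M)"
  proof (rule wp_For[where K = m and I = "\<lambda>i. ?Inv i 0 0"])
    fix i R1 M1
    assume i: "i < m" "R1 ri = i" "\<And>z. z \<notin> insert ri (mods ?c) \<Longrightarrow> R1 z = R0 z"
      and I: "?Inv i 0 0 R1 M1"
    have R1: "R1 rn = n" "R1 rm = m" using i(3) R0 by (simp_all add: mods_extend incr_def)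
    show "wp N ?c (\<lambda>s. ?Inv (Suc i) 0 0 ((fst s)(ri := Suc i)) (snd s)) (R1, M1)"
      unfolding wp.simps(4)
    proof (rule wp_For[where K = n and I = "\<lambda>a. ?Inv i a 0"])
      fix a R2 M2
      assume a: "a < n" "R2 ra = a"
        "\<And>z. z \<notin> insert ra (mods (For rb rn extend)) \<Longrightarrow> R2 z = R1 z"
        and I: "?Inv i a 0 R2 M2"
      have R2: "R2 rn = n" "R2 rm = m" using a(3) R1 by (simp_all add: mods_extend)
      show "wp N (For rb rn extend) (\<lambda>s. ?Inv i (Suc a) 0 ((fst s)(ra := Suc a)) (snd s)) (R2, M2)"
      proof (rule wp_For[where K = n and I = "?Inv i a"])
        fix b R3 M3
        assume b: "b < n" "R3 rb = b" "\<And>z. z \<notin> insert rb (mods extend) \<Longrightarrow> R3 z = R2 z"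
          and I: "?Inv i a b R3 M3"
        have R3: "R3 rn = n" "R3 rm = m" "R3 ra = a"
          using b(3) R2 a(2) by (simp_all add: mods_extend)
        from I show "wp N extend (\<lambda>s. ?Inv i a (Suc b) ((fst s)(rb := Suc b)) (snd s)) (R3, M3)"
          by (intro wp_extend[OF N R3(1,2) refl _ _ R3(3) b(2) a(1) b(1)])
            (auto simp: mods_extend)
      qed (use N R2 I grown_next_vertex in \<open>auto simp: mods_extend\<close>)
    next
      fix R2 M2
      assume "\<And>z. z \<notin> insert ra (mods (For rb rn extend)) \<Longrightarrow> R2 z = R1 z" "?Inv i n 0 R2 M2"
      then show "wp N (incr rp (Reg rn)) (\<lambda>s. ?Inv (Suc i) 0 0 ((fst s)(ri := Suc i)) (snd s)) (R2, M2)"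
        using grown_next_row[OF _ m(2)] R1 by (simp add: incr_def mods_extend)
    qed (use N R1 I in \<open>auto simp: mods_extend\<close>)
  next
    fix R' M'
    assume *: "\<And>z. z \<notin> insert ri (mods ?c) \<Longrightarrow> R' z = R0 z" and I: "?Inv m 0 0 R' M'"
    \<comment> \<open>At \<open>i = m\<close> the alternative \<open>i < r\<close> contradicts
      \<open>r \<le> m\<close>, so the search has reached \<open>m\<close> rows.\<close>
    then have "R' rr = m" "family n h m M'" by (auto simp: grown_def)
    with I show "Q (R', M')"
      by (intro Q) (auto simp: * mods_grow mods_extend incr_def R0_def)
  next
    \<comment> \<open>No triple precedes \<open>(0, 0, 0)\<close>, and the queue holds the first
      row.\<close>
    show "?Inv 0 0 0 (R0(ri := 0)) M" using m fam by (simp add: R0_def grown_def)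
  qed (use N R0 in \<open>auto simp: mods_extend incr_def\<close>)
  then show ?thesis by (simp add: grow_def R0_def R)
qed

section \<open>The balancing phase\<close>

definition degrees :: com where
  "degrees = Assign rx (Const 0) ;; Assign ry (Const 0) ;; Assign ru (Const 0) ;;
    For rl rm (incr rx (cell ru ra) ;; incr ry (cell ru rb) ;; incr ru (Reg rn))"

lemma mods_degrees: "mods degrees = {rl, ru, rx, ry}"
  by (auto simp: degrees_def incr_def)

lemma wp_degrees:
  assumes "m \<le> N" "R rm = m" "R rn = n"
    and Q: "\<And>R'. \<lbrakk>\<And>z. z \<notin> {rl, ru, rx, ry} \<Longrightarrow> R' z = R z;
      R' rx = (\<Sum>i<m. M (i * n + R ra)); R' ry = (\<Sum>i<m. M (i * n + R rb))\<rbrakk> \<Longrightarrow> Q (R', M)"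
  shows "wp N degrees Q (R, M)"
proof -
  let ?c = "incr rx (cell ru ra) ;; incr ry (cell ru rb) ;; incr ru (Reg rn)"
  have "wp N (For rl rm ?c) Q (R(rx := 0, ry := 0, ru := 0), M)"
  proof (rule wp_For[where K = m and I = "\<lambda>k R' M'. M' = M \<and> R' ru = k * n \<and>
      R' rx = (\<Sum>i<k. M (i * n + R ra)) \<and> R' ry = (\<Sum>i<k. M (i * n + R rb))"])
    fix k R' M'
    assume "k < m" "R' rl = k" "\<And>z. z \<notin> insert rl (mods ?c) \<Longrightarrow> R' z = (R(rx := 0, ry := 0, ru := 0)) z"
      "M' = M \<and> R' ru = k * n \<and>
        R' rx = (\<Sum>i<k. M (i * n + R ra)) \<and> R' ry = (\<Sum>i<k. M (i * n + R rb))"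
    with assms(2,3) show "wp N ?c (\<lambda>s. snd s = M \<and> ((fst s)(rl := Suc k)) ru = Suc k * n \<and>
        ((fst s)(rl := Suc k)) rx = (\<Sum>i<Suc k. M (i * n + R ra)) \<and>
        ((fst s)(rl := Suc k)) ry = (\<Sum>i<Suc k. M (i * n + R rb))) (R', M')"
      by (simp add: incr_def)
  qed (use assms in \<open>auto simp: incr_def\<close>)
  then show ?thesis by (simp add: degrees_def)
qed

text \<open>Truncated subtraction makes \<open>1 - (k - j)\<close> the indicator of \<open>k \<le> j\<close>, so this is \<open>V ! j\<close>.\<close>

definition target :: "nat \<Rightarrow> expr" where
  "target j = Sub (Reg rv) (Sub (Const 1) (Sub (Reg rk) (Reg j)))"

text \<open>The degrees are recomputed for every triple \<open>(a, b, i)\<close>, so the invariant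
  can speak of the matrix alone. An accepted swap is carried out directly in row
  \<open>i\<close>.\<close>

definition improve :: com where
  "improve = degrees ;; If (Sub (Reg rx) (target ra)) (If (Sub (target rb) (Reg ry))
    (If guard (search ;; If (Reg rf) Skip
      (Store (Add (Reg rp) (Reg ra)) (Const 0) ;; Store (Add (Reg rp) (Reg rb)) (Const 1))) Skip) Skip) Skip"

lemma mods_improve: "mods improve = {rl, ru, rx, ry, rj, re, rf}"
  by (auto simp: improve_def mods_degrees mods_search)

lemma wp_improve:
  defines "W \<equiv> \<lambda>v k j :: nat. v - (1 - (k - j))"
  assumes N: "n \<le> N" "m \<le> N"
    and R: "R rn = n" "R rm = m" "R rr = m" "R rq = m * n" "R rp = i * n" "R ra = a" "R rb = b"
      "R rv = v" "R rk = k"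
    and i: "i < m" "a < n" "b < n"
    and bal: "balanced n h m (W v k) a b i M"
    and Q: "\<And>R' M'. \<lbrakk>\<And>z. z \<notin> mods improve \<Longrightarrow> R' z = R z;
      balanced n h m (W v k) a b (Suc i) M'\<rbrakk> \<Longrightarrow> Q (R', M')"
  shows "wp N improve Q (R, M)"
  unfolding improve_def wp.simps(4)[of _ degrees]
proof (rule wp_degrees[OF N(2) R(2,1)])
  fix R1
  assume R1: "\<And>z. z \<notin> {rl, ru, rx, ry} \<Longrightarrow> R1 z = R z"
    and xy: "R1 rx = (\<Sum>i<m. M (i * n + R ra))" "R1 ry = (\<Sum>i<m. M (i * n + R rb))"
  have fam: "family n h m M" using bal by (simp add: balanced_def)
  have deg: "R1 rx = deg n m M a" "R1 ry = deg n m M b"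
    using xy deg_eq_sum[OF fam] i R by simp_all
  have R1': "R1 rn = n" "R1 rr = m" "R1 rq = m * n" "R1 rp = i * n" "R1 ra = a" "R1 rb = b"
      "R1 rv = v" "R1 rk = k"
    using R by (simp_all add: R1)
  have W: "val (target ra) (R1, M) = W v k a" "val (target rb) (R1, M) = W v k b"
    by (simp_all add: target_def R1' W_def)
  note guard = val_guard[OF fam i R1'(4-6)]
  let ?c = "If (Reg rf) Skip
    (Store (Add (Reg rp) (Reg ra)) (Const 0) ;; Store (Add (Reg rp) (Reg rb)) (Const 1))"
  have known: "Q (R1, M)"
    if "\<lbrakk>W v k a < deg n m M a; deg n m M b < W v k b; a \<in> hedge n M i; b \<notin> hedge n M i\<rbrakk> \<Longrightarrow>
      swp a b (hedge n M i) \<in> hedge n M ` {..<m}"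
    using balanced_known[OF bal that] by (intro Q) (auto simp: mods_improve R1)
  show "wp N (If (Sub (Reg rx) (target ra)) (If (Sub (target rb) (Reg ry))
    (If guard (search ;; ?c) Skip) Skip) Skip) Q (R1, M)"
  proof (cases "W v k a < deg n m M a \<and> deg n m M b < W v k b \<and> a \<in> hedge n M i \<and> b \<notin> hedge n M i")
    case False
    with guard have "\<not> (W v k a < deg n m M a \<and> deg n m M b < W v k b \<and> val guard (R1, M) \<noteq> 0)"
      by blast
    with known[OF False[THEN notE]] show ?thesis by (auto simp: W deg)
  next
    case True
    then have ab: "a \<in> hedge n M i" "b \<notin> hedge n M i" by blast+
    have "wp N search (wp N ?c Q) (R1, M)"
    proof (rule wp_search[OF N R1'(1-6) i fam ab])
      fix R' M'
      assume R': "\<And>z. z \<notin> {rj, re, rf, rl, ru} \<Longrightarrow> R' z = R1 z"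
        and M': "\<And>x. x < m * n \<Longrightarrow> M' x = M x"
        and f: "R' rf = 0 \<longleftrightarrow> swp a b (hedge n M i) \<notin> hedge n M ` {..<m}"
      have frame: "R' z = R z" if "z \<notin> mods improve" for z
        using that R' R1 by (simp add: mods_improve)
      show "wp N ?c Q (R', M')"
      proof (cases "R' rf = 0")
        case False
        have "balanced n h m (W v k) a b (Suc i) M'"
          by (rule balanced_agree[OF balanced_known[OF bal]]) (use False f i M' in simp_all)
        with False frame show ?thesis by (auto intro: Q)
      next
        case 0: True
        \<comment> \<open>The search has written only to the scratch row \<open>m\<close>, so the
          invariant holds just before the swap in place.\<close>
        have bal': "balanced n h m (W v k) a b i M'"
          by (rule balanced_agree[OF bal]) (use i M' in simp_all)
        have same: "hedge n M' i = hedge n M i" "hedge n M' ` {..<m} = hedge n M ` {..<m}"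
          "deg n m M' j = deg n m M j" for j
          using hedge_agree[of m n M' M, OF M' i(1)] image_hedge_agree[of m n M' M, OF M']
            deg_agree[of m n M' M, OF M'] by blast+
        have "balanced n h m (W v k) a b (Suc i) (M'(i * n + a := 0, i * n + b := 1))"
          by (rule balanced_swap[OF bal' i]) (use True 0 f in \<open>simp_all add: same\<close>)
        with 0 frame show ?thesis by (auto intro!: Q simp: R' R1')
      qed
    qed
    with True guard show ?thesis by (simp add: W deg)
  qed
qed

definition balance :: com where
  "balance = For ra rn (For rb rn (Assign rp (Const 0) ;; For ri rm (improve ;; incr rp (Reg rn))))"

lemma wp_balance:
  defines "W \<equiv> \<lambda>v k j :: nat. v - (1 - (k - j))"
  assumes N: "n \<le> N" "m \<le> N"
    and R: "R rn = n" "R rm = m" "R rr = m" "R rq = m * n" "R rv = v" "R rk = k"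
    and fam: "family n h m M"
    and sum: "(\<Sum>j<n. W v k j) = m * h"
    and Q: "\<And>R' M'. \<lbrakk>family n h m M'; \<And>j. j < n \<Longrightarrow> deg n m M' j = W v k j\<rbrakk> \<Longrightarrow> Q (R', M')"
  shows "wp N balance Q (R, M)"
proof -
  let ?bal = "balanced n h m (W v k)"
  let ?row = "improve ;; incr rp (Reg rn)"
  let ?col = "Assign rp (Const 0) ;; For ri rm ?row"
  have mods_row: "mods ?row = {rl, ru, rx, ry, rj, re, rf, rp}"
    by (auto simp: mods_improve incr_def)
  have mods_col: "mods ?col = {rl, ru, rx, ry, rj, re, rf, rp, ri}"
    unfolding mods.simps(4)[of "Assign rp (Const 0)"] mods_For mods_row by auto
  \<comment> \<open>This is where the prescribed degrees taking only the values \<open>v\<close> and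
    \<open>v - 1\<close> enters.\<close>
  have WW: "W v k b \<le> W v k a + 1" for a b by (simp add: W_def)
  show ?thesis
    unfolding balance_def
  proof (rule wp_For[where K = n and I = "\<lambda>a R' M'. ?bal a 0 0 M'"])
    fix a R1 M1
    assume a: "a < n" "R1 ra = a" "\<And>z. z \<notin> insert ra (mods (For rb rn ?col)) \<Longrightarrow> R1 z = R z"
      and I: "?bal a 0 0 M1"
    have R1: "R1 rn = n" "R1 rm = m" "R1 rr = m" "R1 rq = m * n" "R1 rv = v" "R1 rk = k"
      using R a(3) unfolding mods_For mods_col by simp_all
    show "wp N (For rb rn ?col) (\<lambda>s. ?bal (Suc a) 0 0 (snd s)) (R1, M1)"
    proof (rule wp_For[where K = n and I = "\<lambda>b R' M'. ?bal a b 0 M'"])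
      fix b R2 M2
      assume b: "b < n" "R2 rb = b" "\<And>z. z \<notin> insert rb (mods ?col) \<Longrightarrow> R2 z = R1 z"
        and I: "?bal a b 0 M2"
      have R2: "R2 rn = n" "R2 rm = m" "R2 rr = m" "R2 rq = m * n" "R2 ra = a" "R2 rv = v" "R2 rk = k"
        using R1 a(2) b(3) unfolding mods_col by simp_all
      have "wp N (For ri rm ?row) (\<lambda>s. ?bal a (Suc b) 0 (snd s)) (R2(rp := 0), M2)"
      proof (rule wp_For[where K = m and I = "\<lambda>i R' M'. R' rp = i * n \<and> ?bal a b i M'"])
        fix i R3 M3
        assume i: "i < m" "R3 ri = i" "\<And>z. z \<notin> insert ri (mods ?row) \<Longrightarrow> R3 z = (R2(rp := 0)) z"
          and I: "R3 rp = i * n \<and> ?bal a b i M3"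
        have R3: "R3 rn = n" "R3 rm = m" "R3 rr = m" "R3 rq = m * n" "R3 rp = i * n" "R3 ra = a" "R3 rb = b"
          "R3 rv = v" "R3 rk = k"
          using R2 b(2) i(3) I unfolding mods_row by simp_all
        show "wp N ?row (\<lambda>s. ((fst s)(ri := Suc i)) rp = Suc i * n \<and> ?bal a b (Suc i) (snd s)) (R3, M3)"
          unfolding wp.simps(4)
          by (rule wp_improve[OF N R3 i(1) a(1) b(1)])
            (use I in \<open>simp_all add: mods_improve incr_def R3 W_def\<close>)
      qed (use N R2 I balanced_next_pair[OF _ a(1) b(1) WW] in \<open>auto simp: mods_improve incr_def\<close>)
      then show "wp N ?col (\<lambda>s. ?bal a (Suc b) 0 (snd s)) (R2, M2)" by simp
    qed (use N R1 I balanced_next_vertex in \<open>auto simp: mods_improve incr_def\<close>)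
  next
    show "?bal 0 0 0 M" using fam by (simp add: balanced_def)
  next
    fix R' M'
    assume "?bal n 0 0 M'"
    then show "Q (R', M')"
      by (intro Q balanced_final[OF _ sum]) (simp add: balanced_def)
  qed (use N R in \<open>auto simp: mods_improve incr_def\<close>)
qed

section \<open>Reading the input and writing the first edge\<close>

text \<open>The vector \<open>V\<close> starts at address \<open>m + 2\<close>, after the two
  lengths and \<open>H\<close>. Its first entry is taken as \<open>v\<close>, and \<open>rk\<close>
  ends as one more than the last index whose entry is not below \<open>v\<close>.\<close>

definition setup_regs :: com where
  "setup_regs = Assign rm (Mem (Const 0)) ;; Assign rn (Mem (Const 1)) ;; Assign rh (Mem (Const 2)) ;;
    Assign rp (Add (Reg rm) (Const 2)) ;; Assign rv (Mem (Reg rp)) ;; Assign rk (Const 0) ;;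
    For rj rn (If (Sub (Reg rv) (cell rp rj)) Skip (Assign rk (Add (Reg rj) (Const 1))))"

text \<open>The expression is the indicator of \<open>j < h\<close>, so the search starts from the
  edge \<open>{..<h}\<close>. The input may be overwritten from here on, since the registers hold
  all that is needed of it.\<close>

definition first_row :: com where
  "first_row = For rj rn (Store (Reg rj) (Sub (Const 1) (Sub (Add (Reg rj) (Const 1)) (Reg rh))))"

lemma wp_setup_regs:
  assumes N: "length V \<le> N"
    and m: "0 < m" and v: "0 < v" and k: "0 < k" "k \<le> length V"
    and V: "\<And>j. j < length V \<Longrightarrow> V ! j = (if j < k then v else v - 1)"
    and Q: "\<And>R M. \<lbrakk>R rm = m; R rn = length V; R rh = h; R rv = v; R rk = k\<rbrakk> \<Longrightarrow> Q (R, M)"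
  shows "wp N setup_regs Q (input_state (replicate m h) V)"
proof -
  define M where "M = snd (input_state (replicate m h) V)"
  let ?n = "length V"
  let ?c = "If (Sub (Reg rv) (cell rp rj)) Skip (Assign rk (Add (Reg rj) (Const 1)))"
  have st: "input_state (replicate m h) V = (\<lambda>_. 0, M)" by (simp add: M_def input_state_def Let_def)
  have M: "M 0 = m" "M (Suc 0) = ?n" "M 2 = h" "M (m + 2 + j) = V ! j" if "j < ?n" for j
    using m that
    by (simp_all add: M_def input_state_def Let_def nth_append numeral_2_eq_2)
  have n: "0 < ?n" using k by linarith
  have M0: "M 0 = m" "M (Suc 0) = ?n" "M 2 = h" "M (m + 2) = v"
    using M[OF n] V[OF n] k by simp_all
  then have M4: "M (Suc (Suc m)) = v" by simp
  define R0 where "R0 = (\<lambda>_. 0 :: nat)(rm := m, rn := ?n, rh := h, rp := m + 2, rv := v, rk := 0)"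
  have "wp N (For rj rn ?c) Q (R0, M)"
  \<comment> \<open>The register \<open>rk\<close> follows the counter up to \<open>k\<close> and
    then stays, because \<open>v - 1 < v\<close> for positive \<open>v\<close>.\<close>
  proof (rule wp_For[where K = ?n and I = "\<lambda>j R' M'. M' = M \<and> R' rk = min j k"])
    fix j R' M'
    assume j: "j < ?n" "R' rj = j" "\<And>z. z \<notin> insert rj (mods ?c) \<Longrightarrow> R' z = R0 z"
      and I: "M' = M \<and> R' rk = min j k"
    have "R' rv = v" "R' rp = m + 2" using j(3) by (simp_all add: R0_def)
    with I j M(4)[OF j(1)] V[OF j(1)] v
    show "wp N ?c (\<lambda>s. snd s = M \<and> ((fst s)(rj := Suc j)) rk = min (Suc j) k) (R', M')"
      by auto
  qed (use N k Q in \<open>auto simp: R0_def\<close>)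
  then show ?thesis by (simp add: setup_regs_def st M0 M4 R0_def)
qed

lemma wp_first_row:
  assumes "n \<le> N" "R rn = n" "R rh = h" "h \<le> n"
    and Q: "\<And>R' M'. \<lbrakk>\<And>z. z \<noteq> rj \<Longrightarrow> R' z = R z; family n h 1 M'\<rbrakk> \<Longrightarrow> Q (R', M')"
  shows "wp N first_row Q (R, M)"
  unfolding first_row_def
proof (rule wp_For[where K = n and I = "\<lambda>k R' M'. \<forall>j<k. M' j = of_bool (j < h)"])
  fix R' M' :: "nat \<Rightarrow> nat"
  assume R': "\<And>z. z \<notin> insert rj (mods (Store (Reg rj)
      (Sub (Const 1) (Sub (Add (Reg rj) (Const 1)) (Reg rh))))) \<Longrightarrow> R' z = R z"
    and M': "\<forall>j<n. M' j = of_bool (j < h)"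
  \<comment> \<open>By \<open>h \<le> n\<close> the edge fits into the columns and has exactly
    \<open>h\<close> vertices.\<close>
  have "hedge n M' 0 = {..<h}" using M' assms(4) by (auto simp: hedge_def of_bool_def split: if_splits)
  then have "family n h 1 M'" using M' by (simp add: family_def inj_on_def)
  then show "Q (R', M')" using R' by (intro Q) auto
qed (use assms in \<open>auto simp: less_Suc_eq\<close>)

section \<open>Correctness and running time of the whole program\<close>

theorem mainTheorem2:
  "\<exists>(A :: com) (P :: nat poly poly).
    \<forall>(m :: nat) (n :: nat) (h :: nat) (v :: nat) (H :: nat list) (V :: nat list).
      m > 0 \<and> n > 0 \<and> h > 0 \<and> v > 0 \<and>
      H = replicate m h \<and>
      (V = replicate n v \<or>
        (\<exists>k. 0 < k \<and> k < n \<and> V = replicate k v @ replicate (n - k) (v - 1))) \<and>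
      h \<le> n \<and> v \<le> m \<and>
      m * h = (\<Sum>j<n. V ! j) \<and>
      real v \<le> real h / real n * real (n choose h)
      \<longrightarrow>
      (\<exists>t s. exec A (input_state H V) t s \<and> t \<le> poly2 P m n \<and>
        (let M = output_mat m n s in
          binary_mat M \<and> distinct_rows M \<and>
          (\<forall>i<m. row_sum M i = h) \<and>
          (\<forall>j<n. col_sum M j = V ! j)))"
proof -
  define A where "A = setup_regs ;; first_row ;; grow ;; balance"
  \<comment> \<open>Every loop runs over at most \<open>m\<close> rows or \<open>n\<close> columns,
    so \<open>m + n\<close> bounds all iteration counts.\<close>
  obtain P where P: "\<And>m n. bnd (m + n) A = poly2 P m n" using bnd_poly[of A] by blast
  show ?thesis
  proof (rule exI[of _ A], rule exI[of _ P], intro allI impI, elim conjE)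
    fix m n h v :: nat and H V :: "nat list"
    assume pos: "0 < m" "0 < n" "0 < h" "0 < v"
      and H: "H = replicate m h"
      and V: "V = replicate n v \<or>
        (\<exists>k. 0 < k \<and> k < n \<and> V = replicate k v @ replicate (n - k) (v - 1))"
      and hn: "h \<le> n"
      and sum: "m * h = (\<Sum>j<n. V ! j)"
      and v: "real v \<le> real h / real n * real (n choose h)"
    \<comment> \<open>A homogeneous \<open>V\<close> is the case \<open>k = n\<close>, so one
      description covers both shapes.\<close>
    obtain k where k: "0 < k" "k \<le> n" and Vk: "V = replicate k v @ replicate (n - k) (v - 1)"
    proof (cases "V = replicate n v")
      case True
      then show ?thesis using that[of n] pos(2) by simp
    next
      case False
      then show ?thesis using that V by (auto intro: less_imp_le)
    qed
    have len: "length V = n" using k Vk by simp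
    have Vj: "V ! j = (if j < k then v else v - 1)" if "j < n" for j
      using that by (simp add: Vk nth_append)
    \<comment> \<open>This is the form in which \<open>target\<close> computes the prescribed
      degree.\<close>
    then have W: "V ! j = v - (1 - (k - j))" if "j < n" for j
      using that by (simp add: Suc_leI)
    \<comment> \<open>Conditions (2) and (3) combine to m h \<le> n v \<le> h (n choose h), and
      cancelling \<open>h\<close> bounds \<open>m\<close>.\<close>
    have "m * h \<le> (\<Sum>j<n. v)" unfolding sum by (intro sum_mono) (simp add: Vj)
    then have "m * h \<le> n * v" by simp
    then have "real m * real h \<le> real n * real v" by (simp only: of_nat_mult[symmetric] of_nat_le_iff)
    also have "\<dots> \<le> real h * real (n choose h)" using v pos by (simp add: field_simps)
    finally have m: "m \<le> n choose h" using pos by (simp add: mult.commute)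
    define Q where "Q = (\<lambda>s :: state. family n h m (snd s) \<and> (\<forall>j<n. deg n m (snd s) j = V ! j))"
    have "wp (m + n) A Q (input_state H V)"
      unfolding A_def wp.simps(4) H
    proof (rule wp_setup_regs)
      fix R M
      assume R: "R rm = m" "R rn = length V" "R rh = h" "R rv = v" "R rk = k"
      show "wp (m + n) first_row (wp (m + n) grow (wp (m + n) balance Q)) (R, M)"
      proof (rule wp_first_row)
        fix R1 M1
        assume R1: "\<And>z. z \<noteq> rj \<Longrightarrow> R1 z = R z" and M1: "family n h 1 M1"
        show "wp (m + n) grow (wp (m + n) balance Q) (R1, M1)"
        proof (rule wp_grow[OF _ _ _ _ pos(1) m M1])
          fix R2 M2
          assume R2: "\<And>z. z \<notin> mods grow \<Longrightarrow> R2 z = R1 z" "R2 rr = m" "R2 rq = m * n"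
            and M2: "family n h m M2"
          show "wp (m + n) balance Q (R2, M2)"
            by (rule wp_balance[OF _ _ _ _ R2(2,3) _ _ M2])
              (use W sum in \<open>auto simp: R2(1) R1 R len mods_grow Q_def\<close>)
        qed (simp_all add: R1 R len)
      qed (simp_all add: R len hn)
    qed (use len pos k Vj in simp_all)
    from wp_exec[OF this] obtain t s
      where ex: "exec A (input_state H V) t s" and t: "t \<le> bnd (m + n) A" and "Q s" by blast
    then have fam: "family n h m (snd s)" and deg: "\<And>j. j < n \<Longrightarrow> deg n m (snd s) j = V ! j"
      by (auto simp: Q_def)
    define M where "M = output_mat m n s"
    have M: "dim_row M = m" "dim_col M = n"
      "\<And>i j. i < m \<Longrightarrow> j < n \<Longrightarrow> M $$ (i, j) = snd s (i * n + j)"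
      by (simp_all add: M_def output_mat_def)
    have "binary_mat M"
      unfolding binary_mat_def
    proof
      fix x assume "x \<in> elements_mat M"
      then obtain i j where ij: "i < m" "j < n" and x: "x = M $$ (i, j)"
        unfolding elements_mat_def M(1,2) by auto
      have "snd s (i * n + j) \<le> 1" using fam ij by (simp add: family_def)
      with ij show "x \<in> {0, 1}" by (auto simp: x M)
    qed
    moreover have "distinct_rows M"
    proof -
      \<comment> \<open>Equal matrix rows give equal hyperedges, which injectivity of
        \<open>hedge\<close> on the family excludes for different indices.\<close>
      have "i = i'" if "i < m" "i' < m" "row M i = row M i'" for i i'
      proof -
        have "snd s (i * n + j) = snd s (i' * n + j)" if "j < n" for j
          using arg_cong[OF \<open>row M i = row M i'\<close>, of "\<lambda>r. r $ j"] \<open>i < m\<close> \<open>i' < m\<close> that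
          by (simp add: M)
        then have "hedge n (snd s) i = hedge n (snd s) i'" by (rule hedge_cong)
        with fam that show ?thesis by (auto simp: family_def dest: inj_onD)
      qed
      then show ?thesis
        by (auto simp: distinct_rows_def rows_def distinct_map M intro!: inj_onI)
    qed
    moreover have "row_sum M i = h" if "i < m" for i
      using card_hedge_eq_sum[OF fam that] that by (simp add: row_sum_def M)
    moreover have "col_sum M j = V ! j" if "j < n" for j
      using deg[OF that] deg_eq_sum[OF fam that] that by (simp add: col_sum_def M)
    ultimately show "\<exists>t s. exec A (input_state H V) t s \<and> t \<le> poly2 P m n \<and>
        (let M = output_mat m n s in binary_mat M \<and> distinct_rows M \<and>
          (\<forall>i<m. row_sum M i = h) \<and> (\<forall>j<n. col_sum M j = V ! j))"
      using ex t unfolding P M_def Let_def by blast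
  qed
qed

end
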